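(* For every rational number $\alpha \in (\tfrac{1}{2}, 1]$ there exists a connected nilpotent linear algebraic group $G$ over $\mathbb{C}$ such that $p(G) = \alpha$.
   Context: For a linear algebraic group $G$ over $\mathbb{C}$, let $C(G) := \{(a,b) \in G \times G : ab = ba\}$, a Zariski closed subset of $G \times G$. The commuting probability of $G$ is defined as $p(G) := \dfrac{\dim C(G)}{\dim (G\times G)} = \dfrac{\dim C(G)}{2\dim G}$ if $\dim G > 0$, and $p(G) := 1$ if $G$ is finite. *)

theory Defs
  imports
    "HOL-Analysis.Abstract_Topology"
    "HOL-Algebra.Generated_Groups"
    "HOL-Library.Extended_Nat"
    "Jordan_Normal_Form.Matrix"
begin

section \<open>The Zariski topology\<close>

text \<open>
  Polynomial functions in a given set \<open>X\<close> of coordinate functions. Since the complex numbers are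
  infinite, polynomials in finitely many independent coordinates may be identified with the
  functions they define.
\<close>

inductive_set polynomial_functions :: "('a \<Rightarrow> complex) set \<Rightarrow> ('a \<Rightarrow> complex) set"
  for X :: "('a \<Rightarrow> complex) set" where
  coord: "x \<in> X \<Longrightarrow> x \<in> polynomial_functions X"
| const: "(\<lambda>_. c) \<in> polynomial_functions X"
| add: "f \<in> polynomial_functions X \<Longrightarrow> g \<in> polynomial_functions X \<Longrightarrow>
    (\<lambda>a. f a + g a) \<in> polynomial_functions X"
| mult: "f \<in> polynomial_functions X \<Longrightarrow> g \<in> polynomial_functions X \<Longrightarrow>
    (\<lambda>a. f a * g a) \<in> polynomial_functions X"

definition zero_locus :: "'a set \<Rightarrow> ('a \<Rightarrow> complex) set \<Rightarrow> 'a set" where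
  "zero_locus A F = {a \<in> A. \<forall>f\<in>F. f a = 0}"

definition zariski_topology :: "'a set \<Rightarrow> ('a \<Rightarrow> complex) set \<Rightarrow> 'a topology" where
  "zariski_topology A X =
     topology (\<lambda>U. \<exists>F \<subseteq> polynomial_functions X. U = A - zero_locus A F)"

lemma diff_zero_locus: "A - zero_locus A F = {a \<in> A. \<exists>f\<in>F. f a \<noteq> 0}"
  by (simp add: zero_locus_def set_diff_eq cong: conj_cong)

lemma istopology_zariski:
  "istopology (\<lambda>U. \<exists>F \<subseteq> polynomial_functions X. U = A - zero_locus A F)"
  unfolding istopology_def
proof (intro conjI allI impI)
  fix S T
  assume "\<exists>F \<subseteq> polynomial_functions X. S = A - zero_locus A F"
    and "\<exists>F \<subseteq> polynomial_functions X. T = A - zero_locus A F"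
  then obtain F H where F: "F \<subseteq> polynomial_functions X" "S = A - zero_locus A F"
    and H: "H \<subseteq> polynomial_functions X" "T = A - zero_locus A H" by blast
  let ?P = "\<Union>f\<in>F. \<Union>h\<in>H. {\<lambda>a. f a * h a}"
  have "?P \<subseteq> polynomial_functions X"
    using F(1) H(1) by (intro UN_least) (simp add: polynomial_functions.mult subset_iff)
  moreover have "S \<inter> T = A - zero_locus A ?P"
    by (simp add: F(2) H(2) diff_zero_locus Int_def conj_ac cong: conj_cong)
  ultimately show "\<exists>F \<subseteq> polynomial_functions X. S \<inter> T = A - zero_locus A F"
    by (intro exI[of _ ?P] conjI)
next
  fix K
  assume "\<forall>S\<in>K. \<exists>F \<subseteq> polynomial_functions X. S = A - zero_locus A F"
  then obtain F where F: "\<And>S. S \<in> K \<Longrightarrow> F S \<subseteq> polynomial_functions X"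
    "\<And>S. S \<in> K \<Longrightarrow> S = A - zero_locus A (F S)" by metis
  have "(\<Union>S\<in>K. S) = (\<Union>S\<in>K. A - zero_locus A (F S))"
    by (intro SUP_cong refl F(2))
  then have "\<Union>K = (\<Union>S\<in>K. A - zero_locus A (F S))" by simp
  also have "\<dots> = A - zero_locus A (\<Union>S\<in>K. F S)"
    by (simp add: diff_zero_locus Set.set_eq_iff)
  finally show "\<exists>F \<subseteq> polynomial_functions X. \<Union>K = A - zero_locus A F"
    using F(1) by (intro exI[of _ "\<Union>S\<in>K. F S"] conjI UN_least)
qed

lemma openin_zariski_topology:
  "openin (zariski_topology A X) U \<longleftrightarrow>
     (\<exists>F \<subseteq> polynomial_functions X. U = A - zero_locus A F)"
  unfolding zariski_topology_def using istopology_zariski[of X A]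
  by (simp add: topology_inverse')

lemma topspace_zariski_topology [simp]: "topspace (zariski_topology A X) = A"
proof
  show "topspace (zariski_topology A X) \<subseteq> A"
    unfolding topspace_def openin_zariski_topology by blast
  have "A = A - zero_locus A {\<lambda>_. 1}"
    by (auto simp: zero_locus_def)
  then have "openin (zariski_topology A X) A"
    unfolding openin_zariski_topology
    by (intro exI[of _ "{\<lambda>_. 1}"]) (simp add: polynomial_functions.const)
  then show "A \<subseteq> topspace (zariski_topology A X)"
    by (rule openin_subset)
qed

lemma closedin_zariski_topology:
  "closedin (zariski_topology A X) Z \<longleftrightarrow>
     (\<exists>F \<subseteq> polynomial_functions X. Z = zero_locus A F)"
proof -
  have *: "zero_locus A F \<subseteq> A" for F by (auto simp: zero_locus_def)
  have "closedin (zariski_topology A X) Z \<longleftrightarrow>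
      Z \<subseteq> A \<and> (\<exists>F \<subseteq> polynomial_functions X. A - Z = A - zero_locus A F)"
    by (simp add: closedin_def openin_zariski_topology)
  also have "\<dots> \<longleftrightarrow> (\<exists>F \<subseteq> polynomial_functions X. Z = zero_locus A F)"
  proof
    assume "Z \<subseteq> A \<and> (\<exists>F \<subseteq> polynomial_functions X. A - Z = A - zero_locus A F)"
    then obtain F where F: "Z \<subseteq> A" "F \<subseteq> polynomial_functions X" "A - Z = A - zero_locus A F"
      by blast
    then have "Z = zero_locus A F" using *[of F] by blast
    with F(2) show "\<exists>F \<subseteq> polynomial_functions X. Z = zero_locus A F" by blast
  next
    assume "\<exists>F \<subseteq> polynomial_functions X. Z = zero_locus A F"
    with * show "Z \<subseteq> A \<and> (\<exists>F \<subseteq> polynomial_functions X. A - Z = A - zero_locus A F)" by blast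
  qed
  finally show ?thesis .
qed


section \<open>Krull dimension of a topological space\<close>

definition irreducible_in :: "'a topology \<Rightarrow> 'a set \<Rightarrow> bool" where
  "irreducible_in T S \<longleftrightarrow> S \<subseteq> topspace T \<and> S \<noteq> {} \<and>
     (\<forall>Z W. closedin T Z \<and> closedin T W \<and> S \<subseteq> Z \<union> W \<longrightarrow> S \<subseteq> Z \<or> S \<subseteq> W)"

text \<open>The empty space gets dimension 0 here; it does not occur below.\<close>

definition krull_dim :: "'a topology \<Rightarrow> enat" where
  "krull_dim T = Sup {enat k | k. \<exists>Z :: nat \<Rightarrow> 'a set.
     (\<forall>i\<le>k. closedin T (Z i) \<and> irreducible_in T (Z i)) \<and> (\<forall>i<k. Z i \<subset> Z (Suc i))}"


section \<open>Nilpotent groups\<close>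

definition commutator_subgroup :: "('a, 'b) monoid_scheme \<Rightarrow> 'a set \<Rightarrow> 'a set \<Rightarrow> 'a set" where
  "commutator_subgroup G H K = generate G
     (\<Union>h\<in>H. \<Union>k\<in>K. {h \<otimes>\<^bsub>G\<^esub> k \<otimes>\<^bsub>G\<^esub> inv\<^bsub>G\<^esub> h \<otimes>\<^bsub>G\<^esub> inv\<^bsub>G\<^esub> k})"

primrec lower_central_series :: "('a, 'b) monoid_scheme \<Rightarrow> nat \<Rightarrow> 'a set" where
  "lower_central_series G 0 = carrier G"
| "lower_central_series G (Suc i) = commutator_subgroup G (lower_central_series G i) (carrier G)"

definition nilpotent_group :: "('a, 'b) monoid_scheme \<Rightarrow> bool" where
  "nilpotent_group G \<longleftrightarrow> group G \<and> (\<exists>c. lower_central_series G c = {\<one>\<^bsub>G\<^esub>})"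


section \<open>Linear algebraic groups\<close>

definition GL :: "nat \<Rightarrow> complex mat monoid" where
  "GL n = units_of (ring_mat TYPE(complex) n ())"

lemma group_GL: "group (GL n)"
proof -
  interpret semiring "ring_mat TYPE(complex) n ()" by (rule semiring_mat)
  show ?thesis unfolding GL_def by (rule units_group)
qed

definition mat_zariski :: "nat \<Rightarrow> complex mat topology" where
  "mat_zariski n = zariski_topology (carrier_mat n n)
     {\<lambda>M. M $$ (i, j) | i j. i < n \<and> j < n}"

text \<open>
  The Zariski topology on the affine space of pairs of matrices, in its own \<open>2n\<^sup>2\<close> coordinates;
  this is finer than the product of the two Zariski topologies.
\<close>

definition mat_pair_zariski :: "nat \<Rightarrow> (complex mat \<times> complex mat) topology" where
  "mat_pair_zariski n = zariski_topology (carrier_mat n n \<times> carrier_mat n n)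
     ({\<lambda>(M, N). M $$ (i, j) | i j. i < n \<and> j < n} \<union>
      {\<lambda>(M, N). N $$ (i, j) | i j. i < n \<and> j < n})"

text \<open>
  The Zariski topology on \<open>GL n\<close>, as a principal open subset of the affine space of matrices,
  is the subspace topology.
\<close>

definition linear_algebraic_group :: "nat \<Rightarrow> complex mat set \<Rightarrow> bool" where
  "linear_algebraic_group n G \<longleftrightarrow>
     subgroup G (GL n) \<and> closedin (subtopology (mat_zariski n) (carrier (GL n))) G"

definition zariski_connected :: "nat \<Rightarrow> complex mat set \<Rightarrow> bool" where
  "zariski_connected n G \<longleftrightarrow> connected_space (subtopology (mat_zariski n) G)"

definition commuting_variety :: "complex mat set \<Rightarrow> (complex mat \<times> complex mat) set" where
  "commuting_variety G = {(a, b) \<in> G \<times> G. a * b = b * a}"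

definition variety_pair_dim :: "nat \<Rightarrow> (complex mat \<times> complex mat) set \<Rightarrow> enat" where
  "variety_pair_dim n S = krull_dim (subtopology (mat_pair_zariski n) S)"

text \<open>
  A linear algebraic group has positive dimension iff it is infinite. All dimensions occurring
  here are finite, so \<open>the_enat\<close> is harmless.
\<close>

definition commuting_probability :: "nat \<Rightarrow> complex mat set \<Rightarrow> real" where
  "commuting_probability n G =
     (if finite G then 1
      else real (the_enat (variety_pair_dim n (commuting_variety G))) /
           real (the_enat (variety_pair_dim n (G \<times> G))))"

end

theory Submission
  imports Defs "HOL-Computational_Algebra.Formal_Power_Series" "HOL-Computational_Algebra.Polynomial"
    "Jordan_Normal_Form.Determinant"
begin

text \<open>
  Let \<open>G\<close> be the group of substitutions \<open>t \<mapsto> t + v\<^sub>1 t\<^sup>2 + \<dots> + v\<^sub>m t ^ (m + 1)\<close> modulo \<open>t ^ (m + 2)\<close>,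
  times a vector group, of total dimension \<open>n - 1\<close>. If the first nonzero coefficient of \<open>v\<close> is
  \<open>v\<^sub>i\<close>, the substitutions commuting with \<open>v\<close> are given by rational functions of \<open>v\<close> and of their
  own coefficients with index \<open>i\<close> or greater than \<open>m - i\<close>, since the two compositions of \<open>v\<close>
  and \<open>w\<close> differ at index \<open>i + j\<close> by \<open>(i - j) v\<^sub>i w\<^sub>j\<close> plus terms in \<open>v\<close> and the \<open>w\<^sub>k\<close> with \<open>k < j\<close>. Hence the commuting variety is a finite union of
  pieces of dimension at most \<open>2n - m\<close>. For even \<open>m\<close> the bound is attained by the square of the
  abelian subgroup of substitutions with \<open>v\<^sub>j = 0\<close> for \<open>j < m / 2\<close>. So \<open>p(G) = (2n - m) / (2n - 2)\<close>,
  which takes every rational value in \<open>(1/2, 1]\<close>.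

  The Krull dimension is bounded from above by counting: a chain of irreducible closed sets of
  length \<open>k\<close> yields \<open>k\<close> algebraically independent functions, hence of the order of \<open>N ^ k\<close> linearly
  independent monomials in them with exponents at most \<open>N\<close>, while on a piece with \<open>d\<close> free
  coordinates these lie in a space of dimension of the order of \<open>N ^ d\<close>.
\<close>

section \<open>Rings of functions\<close>

locale function_ring =
  fixes R :: "('a \<Rightarrow> complex) set"
  assumes const: "(\<lambda>_. c) \<in> R"
    and add: "f \<in> R \<Longrightarrow> g \<in> R \<Longrightarrow> (\<lambda>x. f x + g x) \<in> R"
    and mult: "f \<in> R \<Longrightarrow> g \<in> R \<Longrightarrow> (\<lambda>x. f x * g x) \<in> R"
begin

lemma diff: "f \<in> R \<Longrightarrow> g \<in> R \<Longrightarrow> (\<lambda>x. f x - g x) \<in> R"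
  using add[OF _ mult[OF const[of "-1"]], of f g] by simp

lemma sum: "(\<And>i. i \<in> I \<Longrightarrow> f i \<in> R) \<Longrightarrow> (\<lambda>x. \<Sum>i\<in>I. f i x) \<in> R"
  by (induction I rule: infinite_finite_induct) (auto intro: const add)

lemma power: "f \<in> R \<Longrightarrow> (\<lambda>x. f x ^ k) \<in> R"
  by (induction k) (auto intro: const mult)

lemma polynomial_functions_pullback:
  assumes "u \<in> polynomial_functions X" "\<And>f. f \<in> X \<Longrightarrow> (\<lambda>t. f (\<gamma> t)) \<in> R"
  shows "(\<lambda>t. u (\<gamma> t)) \<in> R"
  using assms(1) by induction (auto intro: assms(2) const add mult)

lemma fps_power_nth:
  assumes "\<And>l. l \<le> s \<Longrightarrow> (\<lambda>x. fps_nth (F x) l) \<in> R"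
  shows "(\<lambda>x. fps_nth (F x ^ k) s) \<in> R"
  using assms
proof (induction k arbitrary: s)
  case 0
  then show ?case by (cases s) (auto intro: const)
next
  case (Suc k)
  have "(\<lambda>x. \<Sum>l=0..s. fps_nth (F x) l * fps_nth (F x ^ k) (s - l)) \<in> R"
    by (intro sum mult Suc.prems Suc.IH) auto
  then show ?case by (simp add: fps_mult_nth)
qed

text \<open>In the convolution of F with F ^ k only the terms l = 0 and l = s involve index s, and
  since the constant coefficient is 1 each factor contributes one copy of the s-th coefficient; the
  rest involves lower coefficients alone.\<close>

lemma fps_power_nth_linear:
  assumes "\<And>l. l < s \<Longrightarrow> (\<lambda>x. fps_nth (F x) l) \<in> R" "\<And>x. fps_nth (F x) 0 = 1" "0 < s"
  shows "(\<lambda>x. fps_nth (F x ^ k) s - of_nat k * fps_nth (F x) s) \<in> R"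
proof (induction k)
  case 0
  then show ?case using assms(3) by (auto intro: const)
next
  case (Suc k)
  have nth0: "fps_nth (F x ^ k) 0 = 1" for x
    using assms(2) by (induction k) auto
  have "(\<lambda>x. (fps_nth (F x ^ k) s - of_nat k * fps_nth (F x) s) +
     (\<Sum>l\<in>{0<..<s}. fps_nth (F x) l * fps_nth (F x ^ k) (s - l))) \<in> R"
    by (intro add Suc.IH sum mult assms(1) fps_power_nth) auto
  moreover have "{0..s} = insert 0 (insert s {0<..<s})" using assms(3) by auto
  then have "fps_nth (F x ^ Suc k) s = fps_nth (F x ^ k) s + (fps_nth (F x) s +
     (\<Sum>l\<in>{0<..<s}. fps_nth (F x) l * fps_nth (F x ^ k) (s - l)))" for x
    using assms(2,3) nth0 by (simp add: fps_mult_nth)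
  ultimately show ?case by (simp add: algebra_simps)
qed

end

lemma function_ring_polynomial_functions: "function_ring (polynomial_functions X)"
  by standard (auto intro: polynomial_functions.intros)

lemma function_ring_poly: "function_ring (range poly)"
proof
  show "(\<lambda>_. c) \<in> range poly" for c :: complex
    by (intro image_eqI[of _ _ "pCons c 0"] ext) auto
next
  fix f g :: "complex \<Rightarrow> complex"
  assume "f \<in> range poly" "g \<in> range poly"
  then obtain p q where "f = poly p" "g = poly q" by blast
  then have "(\<lambda>x. f x + g x) = poly (p + q)" "(\<lambda>x. f x * g x) = poly (p * q)"
    by (auto intro!: ext)
  then show "(\<lambda>x. f x + g x) \<in> range poly" "(\<lambda>x. f x * g x) \<in> range poly"
    by simp_all
qed


section \<open>Counting dimensions of filtered function spaces\<close>

text \<open>Gaussian elimination by induction on the set of equations: a pivot \<open>l0\<close> for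
  the equation \<open>k0\<close> is eliminated from the other equations.\<close>

lemma homogeneous_system_nontrivial_solution:
  fixes A :: "'l \<Rightarrow> 'k \<Rightarrow> 'f::field"
  assumes "finite K" "finite L" "card K < card L"
  shows "\<exists>c. (\<exists>l\<in>L. c l \<noteq> 0) \<and> (\<forall>k\<in>K. (\<Sum>l\<in>L. c l * A l k) = 0)"
  using assms
proof (induction K arbitrary: L A rule: finite_induct)
  case empty
  then have "L \<noteq> {}" by auto
  then show ?case by (intro exI[of _ "\<lambda>_. 1"]) auto
next
  case (insert k0 K)
  show ?case
  proof (cases "\<forall>l\<in>L. A l k0 = 0")
    case True
    moreover have "card K < card L" using insert by simp
    ultimately show ?thesis using insert.IH[OF \<open>finite L\<close>, of A] by auto
  next
    case False
    then obtain l0 where l0: "l0 \<in> L" "A l0 k0 \<noteq> 0" by blast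
    define L' where "L' = L - {l0}"
    define A' where "A' l k = A l k - A l k0 / A l0 k0 * A l0 k" for l k
    have "finite L'" "card K < card L'"
      using insert l0 by (auto simp: L'_def)
    then obtain c where c: "\<exists>l\<in>L'. c l \<noteq> 0" "\<forall>k\<in>K. (\<Sum>l\<in>L'. c l * A' l k) = 0"
      using insert.IH[of L' A'] by blast
    \<comment> \<open>The value of the pivot variable is forced by the equation \<open>k0\<close>;
      inserted into the other equations it turns the coefficients \<open>A\<close> into
      \<open>A'\<close>.\<close>
    define c0 where "c0 = - (\<Sum>l\<in>L'. c l * A l k0) / A l0 k0"
    define c' where "c' = c(l0 := c0)"
    have split: "(\<Sum>l\<in>L. c' l * A l k) = c0 * A l0 k + (\<Sum>l\<in>L'. c l * A l k)" for k
    proof -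
      have "(\<Sum>l\<in>L. c' l * A l k) = c' l0 * A l0 k + (\<Sum>l\<in>L'. c' l * A l k)"
        unfolding L'_def using insert.prems l0 by (intro sum.remove) auto
      also have "(\<Sum>l\<in>L'. c' l * A l k) = (\<Sum>l\<in>L'. c l * A l k)"
        by (intro sum.cong) (auto simp: c'_def L'_def)
      finally show ?thesis by (simp add: c'_def)
    qed
    have "(\<Sum>l\<in>L. c' l * A l k0) = 0"
      unfolding split using l0 by (simp add: c0_def)
    moreover have "(\<Sum>l\<in>L. c' l * A l k) = 0" if "k \<in> K" for k
    proof -
      have "0 = (\<Sum>l\<in>L'. c l * A' l k)" using c that by auto
      also have "\<dots> = (\<Sum>l\<in>L'. c l * A l k) - (\<Sum>l\<in>L'. c l * A l k0) / A l0 k0 * A l0 k"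
        by (simp add: A'_def algebra_simps sum_subtractf sum_distrib_left sum_distrib_right
            sum_divide_distrib)
      finally show ?thesis unfolding split c0_def by simp
    qed
    moreover have "\<exists>l\<in>L. c' l \<noteq> 0" using c(1) by (auto simp: c'_def L'_def)
    ultimately show ?thesis by (intro exI[of _ c']) auto
  qed
qed

text \<open>The inductive form gives the closure properties by induction, also for infinite
  \<open>B\<close>; for finite \<open>B\<close>, \<open>lin_span_eq_sum\<close> recovers a single
  coefficient family.\<close>

inductive_set lin_span :: "('a \<Rightarrow> complex) set \<Rightarrow> ('a \<Rightarrow> complex) set" for B where
  zero: "(\<lambda>_. 0) \<in> lin_span B"
| step: "f \<in> lin_span B \<Longrightarrow> b \<in> B \<Longrightarrow> (\<lambda>x. c * b x + f x) \<in> lin_span B"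

lemma lin_span_base: "b \<in> B \<Longrightarrow> b \<in> lin_span B"
  using lin_span.step[OF lin_span.zero, of b B 1] by simp

lemma lin_span_add:
  assumes "f \<in> lin_span B" "g \<in> lin_span B"
  shows "(\<lambda>x. f x + g x) \<in> lin_span B"
  using assms by induction (auto simp: add.assoc intro: lin_span.step)

lemma lin_span_scale:
  assumes "f \<in> lin_span B"
  shows "(\<lambda>x. a * f x) \<in> lin_span B"
  using assms
proof induction
  case (step f b c)
  then show ?case using lin_span.step[of "\<lambda>x. a * f x" B b "a * c"] by (simp add: algebra_simps)
qed (simp add: lin_span.zero)

lemma lin_span_mult:
  assumes "f \<in> lin_span B" "g \<in> lin_span B'"
    and BB': "\<And>b b'. b \<in> B \<Longrightarrow> b' \<in> B' \<Longrightarrow> (\<lambda>x. b x * b' x) \<in> lin_span C"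
  shows "(\<lambda>x. f x * g x) \<in> lin_span C"
  using assms(1)
proof induction
  case (step f b c)
  have "(\<lambda>x. b x * g x) \<in> lin_span C"
    using assms(2)
  proof induction
    case (step h b' a)
    then show ?case
      using lin_span_add[OF lin_span_scale[OF BB'[OF \<open>b \<in> B\<close>, of b'], of a]]
      by (simp add: algebra_simps)
  qed (simp add: lin_span.zero)
  then show ?case
    using lin_span_add[OF lin_span_scale[of _ C c]] step by (simp add: algebra_simps)
qed (simp add: lin_span.zero)

lemma lin_span_eq_sum:
  assumes "f \<in> lin_span B" "finite B"
  shows "\<exists>c. \<forall>x. f x = (\<Sum>b\<in>B. c b * b x)"
  using assms
proof induction
  case zero
  show ?case by (intro exI[of _ "\<lambda>_. 0"]) simp
next
  case (step f b a)
  then obtain c where c: "\<forall>x. f x = (\<Sum>b\<in>B. c b * b x)" by blast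
  have "a * b x + f x = (\<Sum>b'\<in>B. (c b' + (if b' = b then a else 0)) * b' x)" for x
    using step by (simp add: c distrib_right sum.distrib if_distrib[of "\<lambda>y. y * _"] sum.delta
        cong: if_cong)
  then show ?case by (intro exI[of _ "\<lambda>b'. c b' + (if b' = b then a else 0)"]) blast
qed

text \<open>The functions in \<open>Y\<close> serve as the variables. The exponents are bounded one
  by one, not in total, so that counting exponent tuples is immediate.\<close>

definition monomials :: "('a \<Rightarrow> complex) set \<Rightarrow> nat \<Rightarrow> ('a \<Rightarrow> complex) set" where
  "monomials Y D = {\<lambda>x. \<Prod>y\<in>Y. y x ^ e y | e. \<forall>y\<in>Y. e y \<le> D}"

lemma monomialsI:
  "(\<And>y. y \<in> Y \<Longrightarrow> e y \<le> D) \<Longrightarrow> f = (\<lambda>x. \<Prod>y\<in>Y. y x ^ e y) \<Longrightarrow> f \<in> monomials Y D"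
  unfolding monomials_def by blast

lemma finite_card_monomials:
  assumes "finite Y"
  shows "finite (monomials Y D)" "card (monomials Y D) \<le> (D + 1) ^ card Y"
proof -
  let ?E = "PiE Y (\<lambda>_. {..D})"
  have "monomials Y D \<subseteq> (\<lambda>e x. \<Prod>y\<in>Y. y x ^ e y) ` ?E"
  proof
    fix f assume "f \<in> monomials Y D"
    then obtain e where "\<forall>y\<in>Y. e y \<le> D" "f = (\<lambda>x. \<Prod>y\<in>Y. y x ^ e y)"
      unfolding monomials_def by blast
    then show "f \<in> (\<lambda>e x. \<Prod>y\<in>Y. y x ^ e y) ` ?E"
      by (intro image_eqI[of _ _ "restrict e Y"]) (auto intro!: prod.cong ext)
  qed
  moreover have fin: "finite ?E" using assms by (intro finite_PiE) auto
  ultimately show "finite (monomials Y D)" by (meson finite_imageI finite_subset)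
  have "card (monomials Y D) \<le> card ?E"
    using \<open>monomials Y D \<subseteq> _\<close> fin by (rule surj_card_le[rotated])
  also have "\<dots> = (D + 1) ^ card Y" using assms by (simp add: card_PiE)
  finally show "card (monomials Y D) \<le> (D + 1) ^ card Y" .
qed

definition deg_le :: "('a \<Rightarrow> complex) set \<Rightarrow> nat \<Rightarrow> ('a \<Rightarrow> complex) set" where
  "deg_le Y D = lin_span (monomials Y D)"

lemma deg_le_const: "(\<lambda>_. c) \<in> deg_le Y D"
proof -
  have "(\<lambda>_. 1) \<in> monomials Y D" by (rule monomialsI[of _ "\<lambda>_. 0"]) auto
  then show ?thesis unfolding deg_le_def using lin_span_scale[OF lin_span_base, of "\<lambda>_. 1" _ c] by simp
qed

lemma deg_le_coord:
  assumes "finite Y" "y \<in> Y" "0 < D"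
  shows "y \<in> deg_le Y D"
proof -
  have "y \<in> monomials Y D"
    using assms by (intro monomialsI[of _ "\<lambda>z. if z = y then 1 else 0"])
      (auto simp: if_distrib[of "\<lambda>k. _ ^ k"] prod.delta cong: if_cong)
  then show ?thesis unfolding deg_le_def by (rule lin_span_base)
qed

lemma deg_le_add: "f \<in> deg_le Y D \<Longrightarrow> g \<in> deg_le Y D \<Longrightarrow> (\<lambda>x. f x + g x) \<in> deg_le Y D"
  unfolding deg_le_def by (rule lin_span_add)

lemma deg_le_mult:
  assumes "f \<in> deg_le Y D" "g \<in> deg_le Y D'"
  shows "(\<lambda>x. f x * g x) \<in> deg_le Y (D + D')"
  using assms unfolding deg_le_def
proof (rule lin_span_mult)
  fix b b' assume "b \<in> monomials Y D" "b' \<in> monomials Y D'"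
  then obtain e e' where e: "\<forall>y\<in>Y. e y \<le> D" "b = (\<lambda>x. \<Prod>y\<in>Y. y x ^ e y)"
    and e': "\<forall>y\<in>Y. e' y \<le> D'" "b' = (\<lambda>x. \<Prod>y\<in>Y. y x ^ e' y)"
    unfolding monomials_def by blast
  have "(\<lambda>x. b x * b' x) \<in> monomials Y (D + D')"
    by (rule monomialsI[of _ "\<lambda>y. e y + e' y"])
      (use e e' in \<open>auto simp: power_add prod.distrib add_mono\<close>)
  then show "(\<lambda>x. b x * b' x) \<in> lin_span (monomials Y (D + D'))" by (rule lin_span_base)
qed

text \<open>
  \<open>h ^ D * f\<close> has degree at most \<open>2 * D\<close> in \<open>Y\<close>: this filters the localisation at \<open>h\<close> in such a way
  that \<open>1 / h\<close> does not count as an extra generator.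
\<close>

definition tame :: "('a \<Rightarrow> complex) \<Rightarrow> ('a \<Rightarrow> complex) set \<Rightarrow> 'a set \<Rightarrow> nat \<Rightarrow> ('a \<Rightarrow> complex) set"
  where "tame h Y P D = {f. \<exists>q\<in>deg_le Y (2 * D). \<forall>x\<in>P. h x ^ D * f x = q x}"

lemma tame_const: "(\<lambda>_. c) \<in> tame h Y P 0"
  unfolding tame_def using deg_le_const[of c Y 0] by auto

lemma tame_mult:
  assumes "f \<in> tame h Y P D" "g \<in> tame h Y P D'"
  shows "(\<lambda>x. f x * g x) \<in> tame h Y P (D + D')"
proof -
  obtain p q where "p \<in> deg_le Y (2 * D)" "\<forall>x\<in>P. h x ^ D * f x = p x"
    "q \<in> deg_le Y (2 * D')" "\<forall>x\<in>P. h x ^ D' * g x = q x"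
    using assms unfolding tame_def by blast
  moreover from this have "h x ^ (D + D') * (f x * g x) = p x * q x" if "x \<in> P" for x
    using that unfolding power_add by (metis mult.assoc mult.left_commute)
  ultimately show ?thesis unfolding tame_def
    using deg_le_mult[of p Y "2 * D" q "2 * D'"] by (auto simp: distrib_left)
qed

lemma tame_add:
  assumes "f \<in> tame h Y P D" "g \<in> tame h Y P D"
  shows "(\<lambda>x. f x + g x) \<in> tame h Y P D"
proof -
  obtain p q where "p \<in> deg_le Y (2 * D)" "\<forall>x\<in>P. h x ^ D * f x = p x"
    "q \<in> deg_le Y (2 * D)" "\<forall>x\<in>P. h x ^ D * g x = q x"
    using assms unfolding tame_def by blast
  then show ?thesis unfolding tame_def
    by (intro CollectI bexI[OF _ deg_le_add[of p Y "2 * D" q]]) (auto simp: distrib_left)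
qed

text \<open>Multiplication by h raises the degree by at most 1; the constant 1, counted with degree
  1, pads the bound to \<open>2 * Suc D\<close>.\<close>

lemma tame_Suc:
  assumes "f \<in> tame h Y P D" "h \<in> deg_le Y 1"
  shows "f \<in> tame h Y P (Suc D)"
proof -
  obtain p where "p \<in> deg_le Y (2 * D)" "\<forall>x\<in>P. h x ^ D * f x = p x"
    using assms unfolding tame_def by blast
  then show ?thesis unfolding tame_def
    using deg_le_mult[OF deg_le_const[of 1 Y 1] deg_le_mult[OF assms(2), of p "2 * D"]]
    by (auto simp: mult.assoc)
qed

lemma tame_mono:
  assumes "f \<in> tame h Y P D" "D \<le> D'" "h \<in> deg_le Y 1"
  shows "f \<in> tame h Y P D'"
  using assms(2,1) by (induction rule: dec_induct) (auto intro: tame_Suc assms(3))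

lemma tame_inverse:
  assumes "\<And>x. x \<in> P \<Longrightarrow> h x \<noteq> 0"
  shows "(\<lambda>x. 1 / h x) \<in> tame h Y P 1"
  unfolding tame_def using assms deg_le_const[of 1 Y 2] by auto

lemma tame_power: "f \<in> tame h Y P D \<Longrightarrow> (\<lambda>x. f x ^ k) \<in> tame h Y P (k * D)"
  using tame_const[of 1] tame_mult[of f h Y P D] by (induction k) auto

text \<open>Two elements are raised to a common level by \<open>tame_mono\<close> before they are
  added. This makes the general facts on function rings available for rational functions with powers
  of h as denominators.\<close>

lemma function_ring_tame:
  assumes "h \<in> deg_le Y 1"
  shows "function_ring (\<Union>D. tame h Y P D)"
proof
  fix f g assume "f \<in> (\<Union>D. tame h Y P D)" "g \<in> (\<Union>D. tame h Y P D)"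
  then obtain D D' where *: "f \<in> tame h Y P D" "g \<in> tame h Y P D'" by blast
  then have "f \<in> tame h Y P (max D D')" "g \<in> tame h Y P (max D D')"
    using tame_mono[OF *(1) max.cobounded1 assms] tame_mono[OF *(2) max.cobounded2 assms] by auto
  then show "(\<lambda>x. f x + g x) \<in> (\<Union>D. tame h Y P D)" by (auto dest: tame_add)
  show "(\<lambda>x. f x * g x) \<in> (\<Union>D. tame h Y P D)" using tame_mult[OF *] by auto
qed (auto intro: tame_const)

text \<open>The product h * y can have degree 2 in a single variable, for instance when y is h
  itself; hence the bound \<open>2 * D\<close> in \<open>tame\<close>.\<close>

lemma tame_coord:
  assumes "finite Y" "y \<in> Y" "h \<in> deg_le Y 1"
  shows "y \<in> tame h Y P 1"
  using deg_le_mult[OF assms(3) deg_le_coord[OF assms(1,2), of 1]]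
  by (auto simp: tame_def numeral_2_eq_2)

lemma tame_cong:
  assumes "f \<in> (\<Union>D. tame h Y P D)" "\<And>x. x \<in> P \<Longrightarrow> f x = g x"
  shows "g \<in> (\<Union>D. tame h Y P D)"
  using assms unfolding tame_def by auto

text \<open>After multiplication by h ^ D the whole family lies in the span of the monomials with
  exponents at most \<open>2 * D\<close>. A larger family would satisfy a nontrivial linear relation
  on P, from which h ^ D cancels because h has no zero there.\<close>

lemma tame_family_card_le:
  fixes b :: "nat \<Rightarrow> 'a \<Rightarrow> complex"
  assumes "finite Y" "\<And>x. x \<in> P \<Longrightarrow> h x \<noteq> 0" "\<And>l. l < N \<Longrightarrow> b l \<in> tame h Y P D"
    and indep: "\<And>c. (\<forall>x\<in>P. (\<Sum>l<N. c l * b l x) = 0) \<Longrightarrow> \<forall>l<N. c l = 0"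
  shows "N \<le> (2 * D + 1) ^ card Y"
proof (rule ccontr)
  let ?K = "monomials Y (2 * D)"
  assume "\<not> N \<le> (2 * D + 1) ^ card Y"
  then have less: "card ?K < card {..<N}"
    using finite_card_monomials(2)[OF assms(1), of "2 * D"] by simp
  have fin: "finite ?K" using assms(1) by (rule finite_card_monomials)
  have "\<exists>A. \<forall>x\<in>P. h x ^ D * b l x = (\<Sum>k\<in>?K. A k * k x)" if l: "l < N" for l
  proof -
    obtain q where q: "q \<in> lin_span ?K" "\<forall>x\<in>P. h x ^ D * b l x = q x"
      using assms(3)[OF l] unfolding tame_def deg_le_def by blast
    show ?thesis using lin_span_eq_sum[OF q(1) fin] q(2) by auto
  qed
  then have "\<forall>l. \<exists>A. l < N \<longrightarrow> (\<forall>x\<in>P. h x ^ D * b l x = (\<Sum>k\<in>?K. A k * k x))" by blast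
  from choice[OF this]
  obtain A where A: "\<forall>x\<in>P. h x ^ D * b l x = (\<Sum>k\<in>?K. A l k * k x)" if "l < N" for l by blast
  obtain c where c: "\<exists>l\<in>{..<N}. c l \<noteq> 0" "\<forall>k\<in>?K. (\<Sum>l<N. c l * A l k) = 0"
    using homogeneous_system_nontrivial_solution[OF fin _ less, of A] by auto
  have "(\<Sum>l<N. c l * b l x) = 0" if x: "x \<in> P" for x
  proof -
    have "h x ^ D * (\<Sum>l<N. c l * b l x) = (\<Sum>l<N. c l * (\<Sum>k\<in>?K. A l k * k x))"
      using A x by (simp add: sum_distrib_left mult.left_commute)
    also have "\<dots> = (\<Sum>k\<in>?K. (\<Sum>l<N. c l * A l k) * k x)"
      unfolding sum_distrib_left sum_distrib_right mult.assoc by (rule sum.swap)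
    also have "\<dots> = 0" using c(2) by simp
    finally show ?thesis using assms(2)[OF x] by simp
  qed
  then show False using indep[of c] c(1) by auto
qed

section \<open>Bounds for the Krull dimension\<close>

lemma subtopology_zariski_topology:
  "subtopology (zariski_topology A X) S = zariski_topology (A \<inter> S) X"
proof -
  have "(A - zero_locus A F) \<inter> S = A \<inter> S - zero_locus (A \<inter> S) F" for F
    by (auto simp: zero_locus_def)
  then show ?thesis
    unfolding topology_eq openin_subtopology openin_zariski_topology by metis
qed

text \<open>The zero loci of f and g are closed and cover Z. In other words, the coordinate ring of
  an irreducible set is a domain.\<close>

lemma irreducible_in_vanishing:
  assumes "irreducible_in (zariski_topology S X) Z"
    and "f \<in> polynomial_functions X" "g \<in> polynomial_functions X" "\<And>x. x \<in> Z \<Longrightarrow> f x * g x = 0"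
  shows "(\<forall>x\<in>Z. f x = 0) \<or> (\<forall>x\<in>Z. g x = 0)"
proof -
  have ZS: "Z \<subseteq> S" using assms(1) unfolding irreducible_in_def by simp
  have "closedin (zariski_topology S X) (zero_locus S {f})"
    "closedin (zariski_topology S X) (zero_locus S {g})"
    using assms(2,3) unfolding closedin_zariski_topology by blast+
  moreover have "Z \<subseteq> zero_locus S {f} \<union> zero_locus S {g}"
    using assms(4) ZS unfolding zero_locus_def by auto
  ultimately have "Z \<subseteq> zero_locus S {f} \<or> Z \<subseteq> zero_locus S {g}"
    using assms(1) unfolding irreducible_in_def by blast
  then show ?thesis unfolding zero_locus_def by auto
qed

lemma irreducible_in_prod_nonzero:
  assumes "irreducible_in (zariski_topology S X) Z" "finite I"
    and "\<And>i. i \<in> I \<Longrightarrow> f i \<in> polynomial_functions X" "\<And>i. i \<in> I \<Longrightarrow> \<exists>x\<in>Z. f i x \<noteq> 0"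
  shows "(\<lambda>x. \<Prod>i\<in>I. f i x) \<in> polynomial_functions X \<and> (\<exists>x\<in>Z. (\<Prod>i\<in>I. f i x) \<noteq> 0)"
  using assms(2,3,4)
proof (induction I rule: finite_induct)
  case empty
  then show ?case using assms(1) by (auto simp: irreducible_in_def intro: polynomial_functions.const)
next
  case (insert i I)
  then have IH: "(\<lambda>x. \<Prod>i\<in>I. f i x) \<in> polynomial_functions X" "\<exists>x\<in>Z. (\<Prod>i\<in>I. f i x) \<noteq> 0"
    by auto
  have "\<exists>x\<in>Z. f i x * (\<Prod>i\<in>I. f i x) \<noteq> 0"
  proof (rule ccontr)
    assume "\<not> ?thesis"
    then have "(\<forall>x\<in>Z. f i x = 0) \<or> (\<forall>x\<in>Z. (\<Prod>i\<in>I. f i x) = 0)"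
      using insert.prems IH by (intro irreducible_in_vanishing[OF assms(1)]) auto
    then show False using IH(2) insert.prems(2)[of i] by auto
  qed
  then show ?case using insert IH by (auto intro: polynomial_functions.mult)
qed

text \<open>
  The functions \<open>f i\<close> are algebraically independent on the last member of the chain: a relation can
  be divided by powers of the last function and then restricted to the previous member. The family
  \<open>b\<close> consists of the monomials in the \<open>f i\<close> with exponents at most \<open>N\<close>.
\<close>

lemma chain_independent_family:
  fixes Z :: "nat \<Rightarrow> 'a set"
  assumes "\<And>i. i \<le> k \<Longrightarrow> irreducible_in (zariski_topology S X) (Z i)"
    and "\<And>i. i < k \<Longrightarrow> Z i \<subseteq> Z (Suc i)"
    and "\<And>i. i < k \<Longrightarrow> f i \<in> polynomial_functions X"
    and "\<And>i. i < k \<Longrightarrow> f i \<in> tame h Y P E"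
    and "\<And>i x. i < k \<Longrightarrow> x \<in> Z i \<Longrightarrow> f i x = 0"
    and "\<And>i. i < k \<Longrightarrow> \<exists>x\<in>Z (Suc i). f i x \<noteq> 0"
    and h: "h \<in> deg_le Y 1"
  shows "\<exists>b. (\<forall>l<Suc N ^ k. b l \<in> polynomial_functions X \<and> b l \<in> tame h Y P (k * (N * E))) \<and>
     (\<forall>c. (\<forall>x\<in>Z k. (\<Sum>l<Suc N ^ k. c l * b l x) = 0) \<longrightarrow> (\<forall>l<Suc N ^ k. c l = 0))"
  using assms(1-6)
proof (induction k)
  case 0
  then have "Z 0 \<noteq> {}" by (simp add: irreducible_in_def)
  then show ?case
    by (intro exI[of _ "\<lambda>_ _. 1"]) (auto intro: tame_const polynomial_functions.const)
next
  case (Suc k)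
  interpret function_ring "polynomial_functions X" by (rule function_ring_polynomial_functions)
  let ?K = "Suc N ^ k"
  have "?K > 0" by simp
  have "\<exists>b. (\<forall>l<?K. b l \<in> polynomial_functions X \<and> b l \<in> tame h Y P (k * (N * E))) \<and>
     (\<forall>c. (\<forall>x\<in>Z k. (\<Sum>l<?K. c l * b l x) = 0) \<longrightarrow> (\<forall>l<?K. c l = 0))"
    using Suc.prems by (intro Suc.IH) auto
  then obtain b where b: "\<And>l. l < ?K \<Longrightarrow> b l \<in> polynomial_functions X"
    "\<And>l. l < ?K \<Longrightarrow> b l \<in> tame h Y P (k * (N * E))"
    and indep: "\<And>c. \<forall>x\<in>Z k. (\<Sum>l<?K. c l * b l x) = 0 \<Longrightarrow> \<forall>l<?K. c l = 0"
    by blast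
  have fk: "f k \<in> polynomial_functions X" "f k \<in> tame h Y P E" using Suc.prems by auto
  \<comment> \<open>The index l is read in base \<open>Suc N\<close>: its leading digit
    \<open>l div ?K\<close> is the exponent of the new function \<open>f k\<close>, and the
    remainder selects a monomial in the earlier functions.\<close>
  define b' where "b' l x = b (l mod ?K) x * f k x ^ (l div ?K)" for l x
  have "b' l \<in> polynomial_functions X" "b' l \<in> tame h Y P (Suc k * (N * E))"
    if "l < Suc N ^ Suc k" for l
  proof -
    have mod: "l mod ?K < ?K" by simp
    have div: "l div ?K \<le> N"
      using that less_mult_imp_div_less[of l "Suc N" ?K] by (simp add: less_Suc_eq_le)
    show "b' l \<in> polynomial_functions X"
      unfolding b'_def[abs_def] by (intro mult power fk b(1) mod)
    have "(\<lambda>x. f k x ^ (l div ?K)) \<in> tame h Y P (N * E)"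
      by (rule tame_mono[OF tame_power[OF fk(2)] _ h]) (use div in simp)
    then have "b' l \<in> tame h Y P (k * (N * E) + N * E)"
      unfolding b'_def[abs_def] by (intro tame_mult b(2) mod)
    then show "b' l \<in> tame h Y P (Suc k * (N * E))" by (simp add: add.commute)
  qed
  moreover have "\<forall>l<Suc N ^ Suc k. c l = 0"
    if c: "\<forall>x\<in>Z (Suc k). (\<Sum>l<Suc N ^ Suc k. c l * b' l x) = 0" for c
  proof (rule ccontr)
    define g where "g j x = (\<Sum>l<?K. c (j * ?K + l) * b l x)" for j x
    have g: "g j \<in> polynomial_functions X" for j
      unfolding g_def[abs_def] by (intro sum mult const b) auto
    have expand: "(\<Sum>l<Suc N ^ Suc k. c l * b' l x) = (\<Sum>j<Suc N. g j x * f k x ^ j)" for x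
    proof -
      have "(\<Sum>l<Suc N ^ Suc k. c l * b' l x) = (\<Sum>j<Suc N. \<Sum>l\<in>{j * ?K..<j * ?K + ?K}. c l * b' l x)"
        by (simp only: sum.nat_group power_Suc)
      also have "\<dots> = (\<Sum>j<Suc N. g j x * f k x ^ j)"
      proof (rule sum.cong[OF refl])
        fix j
        have "(\<Sum>l\<in>{j * ?K..<j * ?K + ?K}. c l * b' l x)
            = (\<Sum>l<?K. c (j * ?K + l) * b' (j * ?K + l) x)"
          by (subst sum.atLeastLessThan_shift_0) (simp add: lessThan_atLeast0)
        also have "\<dots> = g j x * f k x ^ j"
          unfolding g_def sum_distrib_right b'_def by (intro sum.cong) auto
        finally show "(\<Sum>l\<in>{j * ?K..<j * ?K + ?K}. c l * b' l x) = g j x * f k x ^ j" .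
      qed
      finally show ?thesis .
    qed
    assume "\<not> (\<forall>l<Suc N ^ Suc k. c l = 0)"
    then obtain l0 where l0: "l0 < Suc N * ?K" "c l0 \<noteq> 0" by auto
    define Q where "Q j \<longleftrightarrow> (\<exists>l<?K. c (j * ?K + l) \<noteq> 0)" for j
    \<comment> \<open>The lowest power of \<open>f k\<close> that occurs in the relation. Factoring
      it out leaves u, which vanishes on the irreducible set \<open>Z (Suc k)\<close> because
      \<open>f k\<close> does not vanish identically there.\<close>
    define j where "j = (LEAST j. Q j)"
    have "Q (l0 div ?K)"
      unfolding Q_def using l0 by (intro exI[of _ "l0 mod ?K"]) (simp add: div_mult_mod_eq)
    then have j: "Q j" "j \<le> l0 div ?K" "\<And>j'. j' < j \<Longrightarrow> \<not> Q j'"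
      unfolding j_def by (auto intro: LeastI Least_le dest: not_less_Least)
    have "j < Suc N" using j(2) less_mult_imp_div_less[OF l0(1)] by linarith
    define u where "u x = (\<Sum>j'\<in>{j..<Suc N}. g j' x * f k x ^ (j' - j))" for x
    have u: "u \<in> polynomial_functions X"
      unfolding u_def[abs_def] by (intro sum mult power g fk)
    have "f k x ^ j * u x = 0" if "x \<in> Z (Suc k)" for x
    proof -
      have "0 = (\<Sum>j'<Suc N. g j' x * f k x ^ j')" using c expand that by auto
      also have "\<dots> = (\<Sum>j'\<in>{j..<Suc N}. g j' x * f k x ^ j')"
        using j(3) by (intro sum.mono_neutral_right) (auto simp: g_def Q_def)
      also have "\<dots> = f k x ^ j * u x"
        unfolding u_def sum_distrib_left
        by (intro sum.cong) (auto simp: mult.left_commute simp flip: power_add)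
      finally show ?thesis by simp
    qed
    then have "(\<forall>x\<in>Z (Suc k). f k x ^ j = 0) \<or> (\<forall>x\<in>Z (Suc k). u x = 0)"
      using Suc.prems(1) u fk by (intro irreducible_in_vanishing[of S X] power) auto
    then have u0: "\<forall>x\<in>Z (Suc k). u x = 0" using Suc.prems(6)[of k] by auto
    \<comment> \<open>On \<open>Z k\<close> the function \<open>f k\<close> is zero, so only the
      lowest term of u survives; this contradicts the independence of the family \<open>b\<close> on
      \<open>Z k\<close>.\<close>
    have "g j x = 0" if "x \<in> Z k" for x
    proof -
      have "f k x = 0" "u x = 0" using Suc.prems(2)[of k] Suc.prems(5)[of k x] u0 that by auto
      moreover have "u x = g j x * f k x ^ (j - j) + (\<Sum>j'\<in>{Suc j..<Suc N}. g j' x * f k x ^ (j' - j))"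
        unfolding u_def using \<open>j < Suc N\<close> by (rule sum.atLeast_Suc_lessThan)
      moreover have "(\<Sum>j'\<in>{Suc j..<Suc N}. g j' x * f k x ^ (j' - j)) = 0"
        using \<open>f k x = 0\<close> by (intro sum.neutral) auto
      ultimately show ?thesis by simp
    qed
    then show False using indep[of "\<lambda>l. c (j * ?K + l)"] j(1) unfolding g_def Q_def by blast
  qed
  ultimately show ?case by (intro exI[of _ b']) blast
qed

text \<open>The top member of a chain lies in the closure of a single piece, so the independent
  family of the chain stays independent on that piece, where its size is bounded by counting
  monomials.\<close>

theorem krull_dim_le:
  fixes P :: "'i \<Rightarrow> 'a set"
  assumes "finite I" "S = (\<Union>p\<in>I. P p)"
    and "\<And>p. p \<in> I \<Longrightarrow> finite (Y p)" "\<And>p. p \<in> I \<Longrightarrow> card (Y p) \<le> d"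
    and h: "\<And>p. p \<in> I \<Longrightarrow> h p \<in> deg_le (Y p) 1" "\<And>p x. p \<in> I \<Longrightarrow> x \<in> P p \<Longrightarrow> h p x \<noteq> 0"
    and tame: "\<And>p. p \<in> I \<Longrightarrow> X \<subseteq> (\<Union>D. tame (h p) (Y p) (P p) D)"
  shows "krull_dim (zariski_topology S X) \<le> enat d"
  unfolding krull_dim_def
proof (rule Sup_least, clarify)
  let ?R = "polynomial_functions X" and ?T = "zariski_topology S X"
  fix k and Z :: "nat \<Rightarrow> 'a set"
  assume Z: "\<forall>i\<le>k. closedin ?T (Z i) \<and> irreducible_in ?T (Z i)" "\<forall>i<k. Z i \<subset> Z (Suc i)"
  have ZS: "Z i \<subseteq> S" if "i \<le> k" for i
    using Z(1) that closedin_subset by fastforce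
  have "\<exists>f\<in>?R. (\<forall>x\<in>Z i. f x = 0) \<and> (\<exists>x\<in>Z (Suc i). f x \<noteq> 0)" if i: "i < k" for i
  proof -
    obtain F where F: "F \<subseteq> ?R" "Z i = zero_locus S F"
      using Z(1) i unfolding closedin_zariski_topology by (meson less_imp_le)
    obtain x where "x \<in> Z (Suc i)" "x \<notin> Z i" using Z(2) i by blast
    then show ?thesis using F ZS[of "Suc i"] i unfolding zero_locus_def by auto
  qed
  then obtain f where f: "\<And>i. i < k \<Longrightarrow> f i \<in> ?R" "\<And>i x. i < k \<Longrightarrow> x \<in> Z i \<Longrightarrow> f i x = 0"
    "\<And>i. i < k \<Longrightarrow> \<exists>x\<in>Z (Suc i). f i x \<noteq> 0"
    by metis
  \<comment> \<open>Otherwise each piece has a polynomial function vanishing on it but not on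
    \<open>Z k\<close>; by irreducibility their product is nonzero somewhere on \<open>Z k\<close>,
    although it vanishes on all of S.\<close>
  have "\<exists>p\<in>I. \<forall>u\<in>?R. (\<forall>x\<in>P p. u x = 0) \<longrightarrow> (\<forall>x\<in>Z k. u x = 0)"
  proof (rule ccontr)
    assume "\<not> ?thesis"
    then obtain u where u: "\<And>p. p \<in> I \<Longrightarrow> u p \<in> ?R" "\<And>p x. p \<in> I \<Longrightarrow> x \<in> P p \<Longrightarrow> u p x = 0"
      "\<And>p. p \<in> I \<Longrightarrow> \<exists>x\<in>Z k. u p x \<noteq> 0"
      by metis
    then obtain x where "x \<in> Z k" "(\<Prod>p\<in>I. u p x) \<noteq> 0"
      using irreducible_in_prod_nonzero[of S X "Z k" I u] Z(1) assms(1) by blast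
    moreover have "x \<in> S" using ZS[of k] \<open>x \<in> Z k\<close> by blast
    ultimately show False using u(2) assms(1,2) by auto
  qed
  then obtain p where p: "p \<in> I"
    and dense: "\<And>u. u \<in> ?R \<Longrightarrow> \<forall>x\<in>P p. u x = 0 \<Longrightarrow> \<forall>x\<in>Z k. u x = 0" by blast
  interpret T: function_ring "\<Union>D. tame (h p) (Y p) (P p) D"
    by (rule function_ring_tame[OF h(1)[OF p]])
  have "u \<in> (\<Union>D. tame (h p) (Y p) (P p) D)" if "u \<in> ?R" for u
    using T.polynomial_functions_pullback[OF that, of id] tame[OF p] by auto
  then have "\<forall>i. \<exists>E. i < k \<longrightarrow> f i \<in> tame (h p) (Y p) (P p) E" using f(1) by auto
  from choice[OF this]
  obtain E where E: "\<And>i. i < k \<Longrightarrow> f i \<in> tame (h p) (Y p) (P p) (E i)" by auto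
  \<comment> \<open>A common level for all \<open>f i\<close>; it does not depend on N, which is
    still free to grow.\<close>
  define E' where "E' = (\<Sum>i<k. E i)"
  have fE: "f i \<in> tame (h p) (Y p) (P p) E'" if "i < k" for i
  proof (rule tame_mono[OF E[OF that] _ h(1)[OF p]])
    show "E i \<le> E'" unfolding E'_def using that by (intro member_le_sum) auto
  qed
  have main: "Suc N ^ k \<le> (2 * (k * (N * E')) + 1) ^ d" for N
  proof -
    have "\<exists>b. (\<forall>l<Suc N ^ k. b l \<in> ?R \<and> b l \<in> tame (h p) (Y p) (P p) (k * (N * E'))) \<and>
       (\<forall>c. (\<forall>x\<in>Z k. (\<Sum>l<Suc N ^ k. c l * b l x) = 0) \<longrightarrow> (\<forall>l<Suc N ^ k. c l = 0))"
      using Z f fE h(1)[OF p] by (intro chain_independent_family[where S = S and f = f]) (auto simp: psubset_eq)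
    then obtain b where b: "\<And>l. l < Suc N ^ k \<Longrightarrow> b l \<in> ?R"
      "\<And>l. l < Suc N ^ k \<Longrightarrow> b l \<in> tame (h p) (Y p) (P p) (k * (N * E'))"
      and indep: "\<And>c. \<forall>x\<in>Z k. (\<Sum>l<Suc N ^ k. c l * b l x) = 0 \<Longrightarrow> \<forall>l<Suc N ^ k. c l = 0"
      by blast
    interpret R: function_ring ?R by (rule function_ring_polynomial_functions)
    have "Suc N ^ k \<le> (2 * (k * (N * E')) + 1) ^ card (Y p)"
    proof (rule tame_family_card_le[OF assms(3)[OF p] h(2)[OF p] b(2)])
      fix c assume "\<forall>x\<in>P p. (\<Sum>l<Suc N ^ k. c l * b l x) = 0"
      then show "\<forall>l<Suc N ^ k. c l = 0"
        by (intro indep dense R.sum R.mult R.const b(1)) auto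
    qed
    also have "\<dots> \<le> (2 * (k * (N * E')) + 1) ^ d" by (intro power_increasing assms(4)[OF p]) auto
    finally show ?thesis .
  qed
  show "enat k \<le> enat d"
  proof (rule ccontr)
    assume "\<not> enat k \<le> enat d"
    then have "d < k" by simp
    \<comment> \<open>With N equal to the constant of the growth estimate, the upper bound becomes
      \<open>N * Suc N ^ d\<close>, which is just below \<open>Suc N ^ Suc d\<close>.\<close>
    define N where "N = (2 * (k * E') + 1) ^ d"
    have "Suc N ^ k \<le> (2 * (k * (N * E')) + 1) ^ d" by (rule main)
    also have "\<dots> \<le> ((2 * (k * E') + 1) * Suc N) ^ d"
      by (intro power_mono) (auto simp: algebra_simps)
    also have "\<dots> = N * Suc N ^ d" by (simp only: power_mult_distrib flip: N_def)
    also have "\<dots> < Suc N ^ Suc d" by simp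
    also have "\<dots> \<le> Suc N ^ k" using \<open>d < k\<close> by (intro power_increasing) auto
    finally show False by simp
  qed
qed

section \<open>Lower bounds for the dimension, irreducibility and connectedness\<close>

lemma le_krull_dim:
  assumes "\<And>i. i \<le> k \<Longrightarrow> closedin T (Z i)" "\<And>i. i \<le> k \<Longrightarrow> irreducible_in T (Z i)"
    and "\<And>i. i < k \<Longrightarrow> Z i \<subset> Z (Suc i)"
  shows "enat k \<le> krull_dim T"
  unfolding krull_dim_def using assms by (intro Sup_upper) blast

text \<open>If f is nonzero at x and g at y, then along a polynomial curve from x to y both become
  nonzero polynomials in one variable. Their product is nonzero, so the zero loci of f and g cannot
  cover the curve.\<close>

lemma irreducible_in_zariskiI:
  assumes "Z \<subseteq> S" "Z \<noteq> {}"
    and curve: "\<And>x y. x \<in> Z \<Longrightarrow> y \<in> Z \<Longrightarrow>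
      \<exists>\<gamma>. \<gamma> 0 = x \<and> \<gamma> 1 = y \<and> range \<gamma> \<subseteq> Z \<and> (\<forall>f\<in>X. (\<lambda>t. f (\<gamma> t)) \<in> range poly)"
  shows "irreducible_in (zariski_topology S X) Z"
  unfolding irreducible_in_def
proof (intro conjI allI impI)
  fix C W
  assume *: "closedin (zariski_topology S X) C \<and> closedin (zariski_topology S X) W \<and> Z \<subseteq> C \<union> W"
  then obtain F H where F: "F \<subseteq> polynomial_functions X" "C = zero_locus S F"
    and H: "H \<subseteq> polynomial_functions X" "W = zero_locus S H"
    unfolding closedin_zariski_topology by blast
  show "Z \<subseteq> C \<or> Z \<subseteq> W"
  proof (rule ccontr)
    assume "\<not> (Z \<subseteq> C \<or> Z \<subseteq> W)"
    then obtain x y where "x \<in> Z" "x \<notin> C" "y \<in> Z" "y \<notin> W" by blast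
    then obtain f g where fg: "f \<in> F" "f x \<noteq> 0" "g \<in> H" "g y \<noteq> 0"
      using assms(1) unfolding F(2) H(2) zero_locus_def by blast
    obtain \<gamma> where \<gamma>: "\<gamma> 0 = x" "\<gamma> 1 = y" "range \<gamma> \<subseteq> Z" "\<forall>f\<in>X. (\<lambda>t. f (\<gamma> t)) \<in> range poly"
      using curve[OF \<open>x \<in> Z\<close> \<open>y \<in> Z\<close>] by blast
    interpret function_ring "range poly" by (rule function_ring_poly)
    have "(\<lambda>t. u (\<gamma> t)) \<in> range poly" if "u \<in> polynomial_functions X" for u
      using polynomial_functions_pullback[OF that] \<gamma>(4) by blast
    then obtain p q where p: "(\<lambda>t. f (\<gamma> t)) = poly p" and q: "(\<lambda>t. g (\<gamma> t)) = poly q"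
      using fg(1,3) F(1) H(1) by blast
    have "poly p 0 \<noteq> 0" "poly q 1 \<noteq> 0"
      using fg(2,4) \<gamma>(1,2) fun_cong[OF p, of 0] fun_cong[OF q, of 1] by auto
    moreover have "poly (p * q) t = 0" for t
    proof -
      have "\<gamma> t \<in> C \<union> W" using \<gamma>(3) * by blast
      then show ?thesis
        using fg(1,3) fun_cong[OF p, of t] fun_cong[OF q, of t]
        unfolding F(2) H(2) zero_locus_def by auto
    qed
    ultimately show False by (metis poly_all_0_iff_0 mult_eq_0_iff poly_0)
  qed
qed (use assms in auto)

lemma irreducible_in_imp_connected_space:
  assumes "irreducible_in T (topspace T)"
  shows "connected_space T"
  unfolding connected_space_closedin
proof clarify
  fix C W assume "closedin T C" "closedin T W" "topspace T \<subseteq> C \<union> W" "C \<inter> W = {}" "C \<noteq> {}" "W \<noteq> {}"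
  moreover from this have "topspace T \<subseteq> C \<or> topspace T \<subseteq> W"
    using assms unfolding irreducible_in_def by blast
  ultimately show False by (metis closedin_subset disjoint_iff subset_iff ex_in_conv)
qed

section \<open>The substitution group\<close>

text \<open>
  A power series \<open>F\<close> with constant term 1 stands for the substitution \<open>t \<mapsto> t * F(t)\<close> modulo
  \<open>t ^ (m + 2)\<close>. Row \<open>i\<close> of the matrix lists the coefficients of \<open>t ^ 1, \<dots>, t ^ (m + 1)\<close> in
  \<open>(t * F(t)) ^ (i + 1)\<close>. The coefficients of \<open>F\<close> with index in \<open>{m<..<n}\<close> only occur in row \<open>0\<close>;
  they account for a central vector group.
\<close>

definition subst_mat :: "nat \<Rightarrow> nat \<Rightarrow> complex fps \<Rightarrow> complex mat" where
  "subst_mat m n F = mat n n (\<lambda>(i, j).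
     if j \<le> m then if i \<le> j then fps_nth (F ^ Suc i) (j - i) else 0
     else if i = 0 then fps_nth F j else of_bool (i = j))"

text \<open>Up to index m these are the coefficients of the composition of \<open>fps_X * F\<close>
  with the inner series \<open>fps_X * H\<close>, divided by the variable; beyond m the coefficients
  add, as in the vector group.\<close>

definition subst_mult :: "nat \<Rightarrow> complex fps \<Rightarrow> complex fps \<Rightarrow> complex fps" where
  "subst_mult m F H = Abs_fps (\<lambda>j.
     if j \<le> m then \<Sum>k\<le>j. fps_nth F k * fps_nth (H ^ Suc k) (j - k)
     else fps_nth F j + fps_nth H j)"

definition subst_group :: "nat \<Rightarrow> nat \<Rightarrow> complex mat set" where
  "subst_group m n = {subst_mat m n F | F. fps_nth F 0 = 1}"

text \<open>Recovers the group coordinates from row 0. The constant coefficient is set to 1 whatever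
  the matrix is, so that \<open>subst_mat m n (row_fps n A)\<close> always lies in the
  group.\<close>

definition row_fps :: "nat \<Rightarrow> complex mat \<Rightarrow> complex fps" where
  "row_fps n A = Abs_fps (\<lambda>s. if s = 0 then 1 else if s < n then A $$ (0, s) else 0)"

lemma row_fps_nth:
  "fps_nth (row_fps n A) s = (if s = 0 then 1 else if s < n then A $$ (0, s) else 0)"
  by (simp add: row_fps_def)

lemma fps_power_nth_cong:
  fixes F H :: "complex fps"
  assumes "\<And>l. l \<le> s \<Longrightarrow> fps_nth F l = fps_nth H l"
  shows "fps_nth (F ^ k) s = fps_nth (H ^ k) s"
  using assms by (induction k arbitrary: s) (auto simp: fps_mult_nth intro!: sum.cong)

lemma fps_power_nth_0_eq_1: "fps_nth (F ^ k) 0 = (1 :: complex)" if "fps_nth F 0 = 1"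
  using that by (induction k) auto

lemma subst_mat_carrier [simp]: "subst_mat m n F \<in> carrier_mat n n"
  "dim_row (subst_mat m n F) = n" "dim_col (subst_mat m n F) = n"
  by (auto simp: subst_mat_def)

lemma subst_mat_row0: "j < n \<Longrightarrow> subst_mat m n F $$ (0, j) = fps_nth F j"
  by (simp add: subst_mat_def)

lemma subst_mat_cong:
  assumes "\<And>l. l < n \<Longrightarrow> fps_nth F l = fps_nth H l"
  shows "subst_mat m n F = subst_mat m n H"
proof -
  have "fps_nth (F ^ Suc i) (j - i) = fps_nth (H ^ Suc i) (j - i)" if "j < n" for i j
    using that assms by (intro fps_power_nth_cong) auto
  then show ?thesis unfolding subst_mat_def using assms by (intro cong_mat) auto
qed

lemma subst_mat_row_fps:
  "fps_nth F 0 = 1 \<Longrightarrow> subst_mat m n (row_fps n (subst_mat m n F)) = subst_mat m n F"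
  by (intro subst_mat_cong) (simp add: row_fps_nth subst_mat_row0)

lemma fps_X_mult_power_nth:
  "fps_nth ((fps_X * F) ^ k) s = (if s < k then 0 else fps_nth (F ^ k) (s - k))"
  for F :: "complex fps"
  by (simp add: power_mult_distrib fps_X_power_mult_nth)

text \<open>Taking powers commutes with composition on the right: the power \<open>Suc i\<close> of
  a composite is the composite of that power of the outer series with the inner one. Only agreement
  of U with the composite up to index s is used, since the substitutions are truncated.\<close>

lemma substitution_compose:
  fixes F H U :: "complex fps"
  assumes "\<And>l. l \<le> s \<Longrightarrow> fps_nth U l = (\<Sum>k\<le>l. fps_nth F k * fps_nth (H ^ Suc k) (l - k))"
  shows "fps_nth (U ^ Suc i) s = (\<Sum>k\<le>s. fps_nth (F ^ Suc i) k * fps_nth (H ^ Suc (i + k)) (s - k))"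
proof -
  define C where "C = (fps_X * F) oo (fps_X * H)"
  have nth: "fps_nth ((fps_X * F) ^ Suc i oo (fps_X * H)) (Suc (i + s)) =
     (\<Sum>k\<le>s. fps_nth (F ^ Suc i) k * fps_nth (H ^ Suc (i + k)) (s - k))" for i s
  proof -
    have "fps_nth ((fps_X * F) ^ Suc i oo (fps_X * H)) (Suc (i + s)) =
      (\<Sum>k\<in>{0..Suc (i + s)}. fps_nth ((fps_X * F) ^ Suc i) k * fps_nth ((fps_X * H) ^ k) (Suc (i + s)))"
      by (rule fps_compose_nth)
    also have "\<dots> = (\<Sum>k\<in>{Suc i..Suc (i + s)}. fps_nth (F ^ Suc i) (k - Suc i) * fps_nth (H ^ k) (Suc (i + s) - k))"
      unfolding fps_X_mult_power_nth by (rule sum.mono_neutral_cong_right) auto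
    also have "\<dots> = (\<Sum>k\<le>s. fps_nth (F ^ Suc i) k * fps_nth (H ^ Suc (i + k)) (s - k))"
      by (rule sum.reindex_bij_witness[of _ "\<lambda>k. Suc i + k" "\<lambda>k. k - Suc i"])
        (auto simp: add.commute)
    finally show ?thesis .
  qed
  have C0: "fps_nth C 0 = 0" by (simp add: C_def)
  have "fps_nth (fps_X * U) l = fps_nth C l" if "l \<le> Suc s" for l
  proof (cases l)
    case 0
    then show ?thesis using C0 by simp
  next
    case (Suc l')
    then show ?thesis using nth[of 0 l'] assms[of l'] that by (simp add: C_def)
  qed
  then have U: "fps_nth U l = fps_nth (fps_shift 1 C) l" if "l \<le> s" for l
    using that by (metis Suc_eq_plus1 Suc_le_mono fps_X_mult_nth diff_Suc_1 fps_shift_nth nat.distinct(1))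
  have XC: "fps_X * fps_shift 1 C = C" using C0 by (auto simp: fps_eq_iff)
  have "fps_nth (U ^ Suc i) s = fps_nth (fps_shift 1 C ^ Suc i) s"
    using U by (rule fps_power_nth_cong)
  also have "\<dots> = fps_nth (C ^ Suc i) (Suc (i + s))"
    using fps_X_mult_power_nth[of "fps_shift 1 C" "Suc i" "Suc (i + s)"] unfolding XC by simp
  also have "C ^ Suc i = (fps_X * F) ^ Suc i oo (fps_X * H)"
    unfolding C_def by (rule fps_compose_power) simp
  finally show ?thesis unfolding nth .
qed

text \<open>In the columns up to m this is \<open>substitution_compose\<close>, applied to each row.
  A column j beyond m has nonzero entries only in row 0 and on the diagonal, so only k = 0 and k = j
  contribute and the entries of row 0 add.\<close>

lemma subst_mat_mult:
  assumes "m < n" "fps_nth F 0 = 1" "fps_nth H 0 = 1"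
  shows "subst_mat m n F * subst_mat m n H = subst_mat m n (subst_mult m F H)"
proof (rule eq_matI)
  fix i j assume "i < dim_row (subst_mat m n (subst_mult m F H))"
    "j < dim_col (subst_mat m n (subst_mult m F H))"
  then have ij: "i < n" "j < n" by simp_all
  have "(subst_mat m n F * subst_mat m n H) $$ (i, j) =
      (\<Sum>k<n. subst_mat m n F $$ (i, k) * subst_mat m n H $$ (k, j))"
    using ij by (simp add: scalar_prod_def lessThan_atLeast0)
  also have "\<dots> = subst_mat m n (subst_mult m F H) $$ (i, j)"
  proof (cases "j \<le> m")
    case True
    have "(\<Sum>k<n. subst_mat m n F $$ (i, k) * subst_mat m n H $$ (k, j)) =
      (\<Sum>k\<in>{i..j}. fps_nth (F ^ Suc i) (k - i) * fps_nth (H ^ Suc k) (j - k))"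
      using ij True by (intro sum.mono_neutral_cong_right) (auto simp: subst_mat_def)
    also have "\<dots> = subst_mat m n (subst_mult m F H) $$ (i, j)"
    proof (cases "i \<le> j")
      case i: True
      have "(\<Sum>k\<in>{i..j}. fps_nth (F ^ Suc i) (k - i) * fps_nth (H ^ Suc k) (j - k)) =
        (\<Sum>k\<le>j-i. fps_nth (F ^ Suc i) k * fps_nth (H ^ Suc (i + k)) (j - i - k))"
        using i by (intro sum.reindex_bij_witness[of _ "\<lambda>k. i + k" "\<lambda>k. k - i"]) auto
      also have "\<dots> = fps_nth (subst_mult m F H ^ Suc i) (j - i)"
        using True by (intro substitution_compose[symmetric]) (simp add: subst_mult_def)
      finally show ?thesis using ij True i by (simp add: subst_mat_def)
    qed (use ij True in \<open>simp add: subst_mat_def\<close>)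
    finally show ?thesis .
  next
    case False
    have "(\<Sum>k<n. subst_mat m n F $$ (i, k) * subst_mat m n H $$ (k, j)) =
      (\<Sum>k\<in>{0, j}. subst_mat m n F $$ (i, k) * subst_mat m n H $$ (k, j))"
      using ij False by (intro sum.mono_neutral_right) (auto simp: subst_mat_def)
    also have "\<dots> = subst_mat m n (subst_mult m F H) $$ (i, j)"
      using ij False assms by (simp add: subst_mat_def subst_mult_def)
    finally show ?thesis .
  qed
  finally show "(subst_mat m n F * subst_mat m n H) $$ (i, j) = \<dots>" .
qed simp_all

lemma subst_mult_nth_0: "fps_nth F 0 = 1 \<Longrightarrow> fps_nth H 0 = 1 \<Longrightarrow> fps_nth (subst_mult m F H) 0 = 1"
  by (simp add: subst_mult_def)

lemma subst_mat_1: "subst_mat m n 1 = 1\<^sub>m n"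
  by (rule eq_matI) (auto simp: subst_mat_def)

lemma subst_mat_inverse:
  assumes "m < n" "fps_nth F 0 = 1"
  shows "\<exists>H. fps_nth H 0 = 1 \<and> subst_mat m n F * subst_mat m n H = 1\<^sub>m n"
proof -
  define C where "C = fps_inv (fps_X * F)"
  have C: "(fps_X * F) oo C = fps_X"
    unfolding C_def using assms(2) by (intro fps_inv_right) auto
  have C0: "fps_nth C 0 = 0" by (simp add: C_def fps_inv_def)
  define H' where "H' = fps_shift 1 C"
  have C': "C = fps_X * H'" using C0 by (auto simp: fps_eq_iff H'_def)
  have H': "(\<Sum>k\<le>j. fps_nth F k * fps_nth (H' ^ Suc k) (j - k)) = of_bool (j = 0)" for j
  proof -
    have "of_bool (j = 0) = fps_nth ((fps_X * F) oo (fps_X * H')) (Suc j)"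
      using C unfolding C' by simp
    also have "\<dots> = (\<Sum>k\<in>{0..Suc j}. fps_nth (fps_X * F) k * fps_nth ((fps_X * H') ^ k) (Suc j))"
      by (rule fps_compose_nth)
    also have "\<dots> = (\<Sum>k\<in>{Suc 0..Suc j}. fps_nth F (k - 1) * fps_nth (H' ^ k) (Suc j - k))"
      unfolding fps_X_mult_power_nth by (rule sum.mono_neutral_cong_right) auto
    also have "\<dots> = (\<Sum>k\<le>j. fps_nth F k * fps_nth (H' ^ Suc k) (j - k))"
      by (rule sum.reindex_bij_witness[of _ Suc "\<lambda>k. k - 1"]) auto
    finally show ?thesis by simp
  qed
  \<comment> \<open>The inverse under composition up to index m, the negative in the vector group
    beyond.\<close>
  define H where "H = Abs_fps (\<lambda>j. if j \<le> m then fps_nth H' j else - fps_nth F j)"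
  have "fps_nth H 0 = 1" using H'[of 0] assms(2) by (simp add: H_def)
  moreover have "fps_nth (subst_mult m F H) j = fps_nth 1 j" for j
  proof (cases "j \<le> m")
    case True
    have "fps_nth (H ^ Suc k) (j - k) = fps_nth (H' ^ Suc k) (j - k)" for k
      using True by (intro fps_power_nth_cong) (auto simp: H_def)
    then show ?thesis using True H'[of j] by (simp add: subst_mult_def)
  qed (simp add: subst_mult_def H_def)
  then have "subst_mult m F H = 1" by (simp add: fps_eq_iff)
  ultimately show ?thesis
    using subst_mat_mult[OF assms(1,2)] subst_mat_1 by metis
qed

text \<open>Row 0 determines the matrix, and beyond index m the product is addition, so only the
  coefficients up to m can obstruct commuting.\<close>

lemma subst_mat_commute_iff:
  assumes "m < n" "fps_nth F 0 = 1" "fps_nth H 0 = 1"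
  shows "subst_mat m n F * subst_mat m n H = subst_mat m n H * subst_mat m n F \<longleftrightarrow>
    (\<forall>j\<le>m. (\<Sum>k\<le>j. fps_nth F k * fps_nth (H ^ Suc k) (j - k)) =
            (\<Sum>k\<le>j. fps_nth H k * fps_nth (F ^ Suc k) (j - k)))"
    (is "?L = ?R")
proof
  assume ?L
  then have eq: "subst_mat m n (subst_mult m F H) $$ (0, j) = subst_mat m n (subst_mult m H F) $$ (0, j)" for j
    using assms by (simp add: subst_mat_mult)
  show ?R
  proof (intro allI impI)
    fix j assume "j \<le> m"
    then show "(\<Sum>k\<le>j. fps_nth F k * fps_nth (H ^ Suc k) (j - k)) =
            (\<Sum>k\<le>j. fps_nth H k * fps_nth (F ^ Suc k) (j - k))"
      using eq[of j] assms(1) by (simp add: subst_mat_row0 subst_mult_def)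
  qed
next
  assume ?R
  then have "subst_mult m F H = subst_mult m H F" by (auto simp: subst_mult_def fps_eq_iff)
  then show ?L using assms by (simp add: subst_mat_mult)
qed

section \<open>Unipotent groups are nilpotent\<close>

text \<open>For k = 0 these are the upper triangular and for k = 1 the strictly upper triangular
  matrices; for k at least n only zero is left.\<close>

definition upper_band :: "nat \<Rightarrow> nat \<Rightarrow> complex mat set" where
  "upper_band n k = {A \<in> carrier_mat n n. \<forall>i<n. \<forall>j<n. j < i + k \<longrightarrow> A $$ (i, j) = 0}"

lemma upper_band_mult:
  assumes "A \<in> upper_band n k" "B \<in> upper_band n l"
  shows "A * B \<in> upper_band n (k + l)"
proof -
  have AB: "A \<in> carrier_mat n n" "B \<in> carrier_mat n n" using assms by (auto simp: upper_band_def)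
  have "(A * B) $$ (i, j) = 0" if "i < n" "j < n" "j < i + (k + l)" for i j
  proof -
    have "(A * B) $$ (i, j) = (\<Sum>x\<in>{0..<n}. A $$ (i, x) * B $$ (x, j))"
      using that AB by (auto simp: scalar_prod_def)
    also have "\<dots> = 0"
    proof (rule sum.neutral, clarify)
      fix x assume "x \<in> {0..<n}"
      then show "A $$ (i, x) * B $$ (x, j) = 0"
        using assms that by (cases "x < i + k") (auto simp: upper_band_def)
    qed
    finally show ?thesis .
  qed
  then show ?thesis using AB by (auto simp: upper_band_def)
qed

lemma upper_band_add: "A \<in> upper_band n k \<Longrightarrow> B \<in> upper_band n k \<Longrightarrow> A + B \<in> upper_band n k"
  and upper_band_diff: "A \<in> upper_band n k \<Longrightarrow> B \<in> upper_band n k \<Longrightarrow> A - B \<in> upper_band n k"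
  by (auto simp: upper_band_def)

definition unipotent :: "nat \<Rightarrow> nat \<Rightarrow> complex mat set" where
  "unipotent n k = {A \<in> carrier_mat n n. A - 1\<^sub>m n \<in> upper_band n k}"

lemma unipotent_upper_band: "A \<in> unipotent n k \<Longrightarrow> A \<in> upper_band n 0"
  unfolding unipotent_def
  by (auto simp: upper_band_def)

lemma unipotent_mult:
  assumes "A \<in> unipotent n k" "B \<in> unipotent n k"
  shows "A * B \<in> unipotent n k"
proof -
  have c: "A \<in> carrier_mat n n" "B \<in> carrier_mat n n" using assms by (auto simp: unipotent_def)
  have "A * B - 1\<^sub>m n = (A - 1\<^sub>m n) * B + (B - 1\<^sub>m n)"
    using c by (simp add: minus_mult_distrib_mat[of _ n n]) (rule eq_matI, auto)
  also have "\<dots> \<in> upper_band n k"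
    using upper_band_mult[of "A - 1\<^sub>m n" n k B 0] assms unipotent_upper_band[OF assms(2)]
    by (intro upper_band_add) (auto simp: unipotent_def)
  finally show ?thesis using c by (auto simp: unipotent_def)
qed

lemma unipotent_inverse:
  assumes "A \<in> unipotent n k" "B \<in> upper_band n 0" "A * B = 1\<^sub>m n"
  shows "B \<in> unipotent n k"
proof -
  have c: "A \<in> carrier_mat n n" "B \<in> carrier_mat n n"
    using assms by (auto simp: unipotent_def upper_band_def)
  have "(A - 1\<^sub>m n) * B = 1\<^sub>m n - B"
    using c assms(3) by (simp add: minus_mult_distrib_mat[of _ n n])
  moreover have "(A - 1\<^sub>m n) * B \<in> upper_band n k"
    using upper_band_mult[of "A - 1\<^sub>m n" n k B 0] assms by (auto simp: unipotent_def)
  ultimately have *: "1\<^sub>m n - B \<in> upper_band n k" by simp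
  have "B $$ (i, j) - 1\<^sub>m n $$ (i, j) = 0" if "i < n" "j < n" "j < i + k" for i j
  proof -
    have "(1\<^sub>m n - B) $$ (i, j) = 0" using * that unfolding upper_band_def by blast
    then show ?thesis using c that by auto
  qed
  then show ?thesis using c unfolding unipotent_def upper_band_def by auto
qed

text \<open>The commutator minus 1 equals (AB - BA) A'B', and AB - BA = (A - 1)(B - 1) - (B - 1)(A -
  1) lies in the band \<open>Suc k\<close>.\<close>

lemma unipotent_commutator:
  assumes A: "A \<in> unipotent n k" and B: "B \<in> unipotent n 1"
    and A': "A' \<in> upper_band n 0" "A * A' = 1\<^sub>m n" and B': "B' \<in> upper_band n 0" "B * B' = 1\<^sub>m n"
  shows "A * B * A' * B' \<in> unipotent n (Suc k)"
proof -
  have c: "A \<in> carrier_mat n n" "B \<in> carrier_mat n n" "A' \<in> carrier_mat n n" "B' \<in> carrier_mat n n"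
    using assms by (auto simp: unipotent_def upper_band_def)
  let ?I = "1\<^sub>m n :: complex mat"
  have "B * A * (A' * B') = B * (A * A') * B'"
    using c by (simp add: assoc_mult_mat[of _ n n _ n _ n])
  then have inv: "B * A * (A' * B') = ?I" using c A'(2) B'(2) by simp
  have "(M - ?I) * (N - ?I) = M * N - M - (N - ?I)" if "M \<in> carrier_mat n n" "N \<in> carrier_mat n n" for M N
    using that minus_mult_distrib_mat[of M n n ?I "N - ?I" n] mult_minus_distrib_mat[of M n n N n ?I]
    by (simp add: minus_carrier_mat)
  then have "(A - ?I) * (B - ?I) - (B - ?I) * (A - ?I) = A * B - A - (B - ?I) - (B * A - B - (A - ?I))"
    using c by simp
  also have "\<dots> = A * B - B * A"
    by (rule eq_matI) (use c in auto)
  finally have "(A - ?I) * (B - ?I) - (B - ?I) * (A - ?I) = A * B - B * A" .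
  moreover have "(A - ?I) * (B - ?I) - (B - ?I) * (A - ?I) \<in> upper_band n (Suc k)"
    using upper_band_mult[of "A - ?I" n k "B - ?I" 1] upper_band_mult[of "B - ?I" n 1 "A - ?I" k] A B
    by (intro upper_band_diff) (auto simp: unipotent_def)
  ultimately have "A * B - B * A \<in> upper_band n (Suc k)" by simp
  then have "(A * B - B * A) * (A' * B') \<in> upper_band n (Suc k)"
    using upper_band_mult[OF _ upper_band_mult[OF A'(1) B'(1)], of "A * B - B * A" "Suc k"] by simp
  also have "(A * B - B * A) * (A' * B') = A * B * (A' * B') - B * A * (A' * B')"
    using c by (intro minus_mult_distrib_mat) auto
  also have "A * B * (A' * B') = A * B * A' * B'"
    using c by (simp add: assoc_mult_mat[of _ n n _ n _ n])
  finally show ?thesis using c unfolding inv by (auto simp: unipotent_def)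
qed

lemma GL_simps [simp]:
  "monoid.mult (GL n) = (*)" "\<one>\<^bsub>GL n\<^esub> = 1\<^sub>m n"
  by (simp_all add: GL_def units_of_def ring_mat_simps)

lemma carrier_GL:
  "carrier (GL n) = {A \<in> carrier_mat n n. \<exists>B\<in>carrier_mat n n. B * A = 1\<^sub>m n \<and> A * B = 1\<^sub>m n}"
  by (simp add: GL_def units_of_def Units_def ring_mat_simps)

text \<open>By induction the k-th term of the lower central series lies in
  \<open>unipotent n (Suc k)\<close>, which is trivial once the band has left the matrix.\<close>

theorem nilpotent_group_unipotent:
  assumes sub: "subgroup G (GL n)" and uni: "G \<subseteq> unipotent n 1"
  shows "nilpotent_group ((GL n)\<lparr>carrier := G\<rparr>)"
proof -
  let ?H = "(GL n)\<lparr>carrier := G\<rparr>"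
  interpret H: Group.group ?H
    using sub group_GL by (rule subgroup.subgroup_is_group)
  have inv: "inv\<^bsub>?H\<^esub> A \<in> G" "A * inv\<^bsub>?H\<^esub> A = 1\<^sub>m n" if "A \<in> G" for A
    using H.inv_closed[of A] H.r_inv[of A] that by auto
  have G0: "A \<in> upper_band n 0" if "A \<in> G" for A
    using that uni unipotent_upper_band by blast
  have sub_k: "subgroup (G \<inter> unipotent n k) ?H" for k
  proof (rule H.subgroupI)
    have "1\<^sub>m n \<in> G" using H.one_closed by simp
    moreover have "1\<^sub>m n \<in> unipotent n k" by (auto simp: unipotent_def upper_band_def)
    ultimately show "G \<inter> unipotent n k \<noteq> {}" by blast
    show "G \<inter> unipotent n k \<subseteq> carrier ?H" by simp
    show "inv\<^bsub>?H\<^esub> A \<in> G \<inter> unipotent n k" if "A \<in> G \<inter> unipotent n k" for A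
      using that inv G0 by (auto intro!: unipotent_inverse[of A])
    show "A \<otimes>\<^bsub>?H\<^esub> B \<in> G \<inter> unipotent n k" if "A \<in> G \<inter> unipotent n k" "B \<in> G \<inter> unipotent n k" for A B
      using that H.m_closed[of A B] unipotent_mult[of A n k B] by simp
  qed
  have lcs: "lower_central_series ?H k \<subseteq> G \<inter> unipotent n (Suc k)" for k
  proof (induction k)
    case 0
    then show ?case using uni by simp
  next
    case (Suc k)
    have "A * B * inv\<^bsub>?H\<^esub> A * inv\<^bsub>?H\<^esub> B \<in> G \<inter> unipotent n (Suc (Suc k))"
      if "A \<in> lower_central_series ?H k" "B \<in> G" for A B
    proof
      have A: "A \<in> G" "A \<in> unipotent n (Suc k)" using that Suc by auto
      show "A * B * inv\<^bsub>?H\<^esub> A * inv\<^bsub>?H\<^esub> B \<in> unipotent n (Suc (Suc k))"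
        using A that(2) uni inv G0 by (intro unipotent_commutator) auto
      show "A * B * inv\<^bsub>?H\<^esub> A * inv\<^bsub>?H\<^esub> B \<in> G"
        using H.m_closed A(1) that(2) inv by simp
    qed
    then show ?case
      unfolding lower_central_series.simps commutator_subgroup_def
      by (intro H.generate_subgroup_incl sub_k) auto
  qed
  have "lower_central_series ?H (Suc n) \<subseteq> {1\<^sub>m n}"
  proof
    fix A assume "A \<in> lower_central_series ?H (Suc n)"
    then have A: "A \<in> carrier_mat n n" "A - 1\<^sub>m n \<in> upper_band n (Suc (Suc n))"
      using lcs[of "Suc n"] unfolding unipotent_def by blast+
    have "A $$ (i, j) = 1\<^sub>m n $$ (i, j)" if "i < n" "j < n" for i j
    proof -
      have "(A - 1\<^sub>m n) $$ (i, j) = 0" using A(2) that by (simp add: upper_band_def)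
      then show ?thesis using A(1) that by simp
    qed
    then show "A \<in> {1\<^sub>m n}" using A(1) by (auto intro!: eq_matI)
  qed
  moreover have "1\<^sub>m n \<in> lower_central_series ?H (Suc n)"
    using generate.one[of ?H] by (simp add: commutator_subgroup_def)
  ultimately have "lower_central_series ?H (Suc n) = {\<one>\<^bsub>?H\<^esub>}" by auto
  then show ?thesis unfolding nilpotent_group_def using H.is_group by blast
qed

section \<open>The substitution group is a connected nilpotent linear algebraic group\<close>

lemma subgroup_subst_group:
  assumes "m < n"
  shows "subgroup (subst_group m n) (GL n)"
proof -
  interpret GL: Group.group "GL n" by (rule group_GL)
  have units: "\<exists>H. fps_nth H 0 = 1 \<and> subst_mat m n F * subst_mat m n H = 1\<^sub>m n \<and>
      subst_mat m n H * subst_mat m n F = 1\<^sub>m n" if "fps_nth F 0 = 1" for F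
    using subst_mat_inverse[OF assms that] mat_mult_left_right_inverse[OF subst_mat_carrier(1) subst_mat_carrier(1)]
    by metis
  have sub: "subst_group m n \<subseteq> carrier (GL n)"
    unfolding subst_group_def carrier_GL using units subst_mat_carrier(1) by blast
  show ?thesis
  proof (rule GL.subgroupI[OF sub])
    show "subst_group m n \<noteq> {}"
      unfolding subst_group_def by (auto intro!: exI[of _ 1])
  next
    fix A assume "A \<in> subst_group m n"
    then obtain F where F: "A = subst_mat m n F" "fps_nth F 0 = 1" unfolding subst_group_def by blast
    then obtain H where H: "fps_nth H 0 = 1" "subst_mat m n H * A = 1\<^sub>m n" using units by blast
    then have HG: "subst_mat m n H \<in> subst_group m n" unfolding subst_group_def by blast
    have "inv\<^bsub>GL n\<^esub> A = subst_mat m n H"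
      using H(2) HG \<open>A \<in> _\<close> sub by (intro GL.inv_equality) auto
    then show "inv\<^bsub>GL n\<^esub> A \<in> subst_group m n" using HG by simp
  next
    fix A B assume "A \<in> subst_group m n" "B \<in> subst_group m n"
    then show "A \<otimes>\<^bsub>GL n\<^esub> B \<in> subst_group m n"
      unfolding subst_group_def using subst_mat_mult[OF assms] subst_mult_nth_0 by auto
  qed
qed

lemma subst_group_unipotent: "subst_group m n \<subseteq> unipotent n 1"
proof
  fix A assume "A \<in> subst_group m n"
  then obtain F where F: "A = subst_mat m n F" "fps_nth F 0 = 1" unfolding subst_group_def by blast
  then show "A \<in> unipotent n 1"
    using fps_power_nth_0_eq_1[OF F(2)]
    by (auto simp: unipotent_def upper_band_def subst_mat_def)
qed

lemma (in function_ring) subst_mat_entry: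
  assumes "\<And>s. s < n \<Longrightarrow> (\<lambda>x. fps_nth (F x) s) \<in> R" "i < n" "j < n"
  shows "(\<lambda>x. subst_mat m n (F x) $$ (i, j)) \<in> R"
proof -
  have "(\<lambda>x. fps_nth (F x ^ Suc i) (j - i)) \<in> R"
    using assms by (intro fps_power_nth) auto
  then show ?thesis
    using assms by (cases "j \<le> m"; cases "i \<le> j"; cases "i = 0") (simp_all add: subst_mat_def const del: power_Suc)
qed

lemma (in function_ring) row_fps_nth_in:
  assumes "\<And>s. 0 < s \<Longrightarrow> s < n \<Longrightarrow> (\<lambda>x. A x $$ (0, s)) \<in> R"
  shows "(\<lambda>x. fps_nth (row_fps n (A x)) s) \<in> R"
  using assms by (cases "s = 0"; cases "s < n") (simp_all add: row_fps_nth const)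

text \<open>The fixed-point form turns membership into polynomial equations between the entries,
  which gives closedness.\<close>

lemma subst_group_iff:
  assumes "0 < n"
  shows "A \<in> subst_group m n \<longleftrightarrow> subst_mat m n (row_fps n A) = A"
proof
  assume "subst_mat m n (row_fps n A) = A"
  moreover have "fps_nth (row_fps n A) 0 = 1" by (simp add: row_fps_nth)
  ultimately show "A \<in> subst_group m n" unfolding subst_group_def by (metis (mono_tags) mem_Collect_eq)
qed (auto simp: subst_group_def subst_mat_row_fps)

lemma linear_algebraic_group_subst_group:
  assumes "m < n"
  shows "linear_algebraic_group n (subst_group m n)"
  unfolding linear_algebraic_group_def
proof
  show sub: "subgroup (subst_group m n) (GL n)" using assms by (rule subgroup_subst_group)
  let ?X = "{\<lambda>M. M $$ (i, j) | i j. i < n \<and> j < n} :: (complex mat \<Rightarrow> complex) set"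
  let ?f = "\<lambda>i j A. A $$ (i, j) - subst_mat m n (row_fps n A) $$ (i, j)"
  let ?F = "\<Union>i<n. \<Union>j<n. {?f i j}"
  interpret function_ring "polynomial_functions ?X" by (rule function_ring_polynomial_functions)
  have coord: "(\<lambda>A. A $$ (i, j)) \<in> polynomial_functions ?X" if "i < n" "j < n" for i j
    using that by (intro polynomial_functions.coord) auto
  have "?f i j \<in> polynomial_functions ?X" if "i < n" "j < n" for i j
    using that by (intro diff subst_mat_entry row_fps_nth_in coord) auto
  then have "?F \<subseteq> polynomial_functions ?X" by (intro UN_least) auto
  then have "closedin (mat_zariski n) (zero_locus (carrier_mat n n) ?F)"
    unfolding mat_zariski_def closedin_zariski_topology by blast
  moreover have "zero_locus (carrier_mat n n) ?F = subst_group m n"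
  proof -
    have "(\<forall>f\<in>?F. f A = 0) \<longleftrightarrow> subst_mat m n (row_fps n A) = A" if "A \<in> carrier_mat n n" for A
    proof -
      have "(\<forall>f\<in>?F. f A = 0) \<longleftrightarrow> (\<forall>i<n. \<forall>j<n. A $$ (i, j) = subst_mat m n (row_fps n A) $$ (i, j))"
        by auto
      also have "\<dots> \<longleftrightarrow> subst_mat m n (row_fps n A) = A" using that by (auto intro!: eq_matI)
      finally show ?thesis .
    qed
    moreover have "A \<in> carrier_mat n n" if "A \<in> subst_group m n" for A
      using that by (auto simp: subst_group_def)
    ultimately show ?thesis using subst_group_iff[of n _ m] assms unfolding zero_locus_def by auto
  qed
  moreover have "subst_group m n \<subseteq> carrier (GL n)" using sub by (rule subgroup.subset)
  ultimately show "closedin (subtopology (mat_zariski n) (carrier (GL n))) (subst_group m n)"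
    unfolding closedin_subtopology by auto
qed

text \<open>A filtration from the whole group at p = 1 down to the identity at p = n. It supplies
  the chains for the lower bounds and, at p = m / 2, the large abelian subgroup.\<close>

definition depth_set :: "nat \<Rightarrow> nat \<Rightarrow> nat \<Rightarrow> complex mat set" where
  "depth_set m n p = {subst_mat m n F | F. fps_nth F 0 = 1 \<and> (\<forall>j. 0 < j \<and> j < p \<longrightarrow> fps_nth F j = 0)}"

lemma depth_set_1: "depth_set m n 1 = subst_group m n"
  by (simp add: depth_set_def subst_group_def)

lemma depth_set_eq:
  assumes "p \<le> n" "0 < n"
  shows "depth_set m n p = {A \<in> subst_group m n. \<forall>j. 0 < j \<and> j < p \<longrightarrow> A $$ (0, j) = 0}"
  using assms unfolding depth_set_def subst_group_def by (auto simp: subst_mat_row0)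

text \<open>The conditions on the coefficients are affine, so the line through two series stays in
  the set; the matrix entries are polynomials in the coefficients.\<close>

lemma depth_set_curve:
  assumes "A \<in> depth_set m n p" "B \<in> depth_set m n p"
  shows "\<exists>\<gamma>. \<gamma> 0 = A \<and> \<gamma> 1 = B \<and> range \<gamma> \<subseteq> depth_set m n p \<and>
    (\<forall>i<n. \<forall>j<n. (\<lambda>t. \<gamma> t $$ (i, j)) \<in> range poly)"
proof -
  obtain F H where F: "A = subst_mat m n F" "fps_nth F 0 = 1" "\<forall>j. 0 < j \<and> j < p \<longrightarrow> fps_nth F j = 0"
    and H: "B = subst_mat m n H" "fps_nth H 0 = 1" "\<forall>j. 0 < j \<and> j < p \<longrightarrow> fps_nth H j = 0"
    using assms unfolding depth_set_def by blast
  define C where "C t = F + fps_const t * (H - F)" for t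
  interpret function_ring "range poly" by (rule function_ring_poly)
  have "(\<lambda>t. fps_nth (C t) s) = poly [:fps_nth F s, fps_nth H s - fps_nth F s:]" for s
    by (auto simp: C_def)
  then have "(\<lambda>t. fps_nth (C t) s) \<in> range poly" for s by simp
  then have "\<forall>i<n. \<forall>j<n. (\<lambda>t. subst_mat m n (C t) $$ (i, j)) \<in> range poly"
    by (auto intro: subst_mat_entry)
  moreover have "subst_mat m n (C t) \<in> depth_set m n p" for t
    unfolding depth_set_def using F H by (intro CollectI exI[of _ "C t"]) (auto simp: C_def)
  ultimately show ?thesis
    by (intro exI[of _ "\<lambda>t. subst_mat m n (C t)"]) (auto simp: C_def F(1) H(1))
qed

lemma zariski_connected_subst_group: "zariski_connected n (subst_group m n)"
proof -
  let ?X = "{\<lambda>M. M $$ (i, j) | i j. i < n \<and> j < n} :: (complex mat \<Rightarrow> complex) set"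
  have "subst_group m n \<subseteq> carrier_mat n n" by (auto simp: subst_group_def)
  then have top: "subtopology (mat_zariski n) (subst_group m n) = zariski_topology (subst_group m n) ?X"
    unfolding mat_zariski_def subtopology_zariski_topology by (simp add: Int_absorb1)
  have ne: "subst_mat m n 1 \<in> subst_group m n" by (auto simp: subst_group_def intro!: exI[of _ 1])
  have "irreducible_in (zariski_topology (subst_group m n) ?X) (subst_group m n)"
  proof (rule irreducible_in_zariskiI)
    fix A B assume "A \<in> subst_group m n" "B \<in> subst_group m n"
    then obtain \<gamma> where "\<gamma> 0 = A" "\<gamma> 1 = B" "range \<gamma> \<subseteq> subst_group m n"
      "\<forall>i<n. \<forall>j<n. (\<lambda>t. \<gamma> t $$ (i, j)) \<in> range poly"
      using depth_set_curve[of A m n 1 B] unfolding depth_set_1 by blast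
    then show "\<exists>\<gamma>. \<gamma> 0 = A \<and> \<gamma> 1 = B \<and> range \<gamma> \<subseteq> subst_group m n \<and>
        (\<forall>f\<in>?X. (\<lambda>t. f (\<gamma> t)) \<in> range poly)"
      by (intro exI[of _ \<gamma>]) auto
  qed (use ne in auto)
  then show ?thesis
    unfolding zariski_connected_def top by (intro irreducible_in_imp_connected_space) simp
qed

section \<open>Dimension of the commuting variety\<close>

definition pair_coords :: "nat \<Rightarrow> (complex mat \<times> complex mat \<Rightarrow> complex) set" where
  "pair_coords n = (\<Union>i<n. \<Union>j<n. {\<lambda>x. fst x $$ (i, j), \<lambda>x. snd x $$ (i, j)})"

lemma variety_pair_dim_eq:
  assumes "S \<subseteq> carrier_mat n n \<times> carrier_mat n n"
  shows "variety_pair_dim n S = krull_dim (zariski_topology S (pair_coords n))"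
proof -
  have "{\<lambda>(M, N). M $$ (i, j) | i j. i < n \<and> j < n} \<union> {\<lambda>(M, N). N $$ (i, j) | i j. i < n \<and> j < n}
      = pair_coords n"
    unfolding pair_coords_def case_prod_unfold by blast
  then show ?thesis
    using assms unfolding variety_pair_dim_def mat_pair_zariski_def subtopology_zariski_topology
    by (simp add: Int_absorb1)
qed

section \<open>Lower bound: chains of products of depth sets\<close>

lemma depth_set_strict:
  assumes "0 < q" "q < n"
  shows "depth_set m n (Suc q) \<subset> depth_set m n q"
proof -
  let ?A = "subst_mat m n (1 + fps_X ^ q)"
  have "?A \<in> depth_set m n q"
    unfolding depth_set_def using assms by (intro CollectI exI[of _ "1 + fps_X ^ q"]) auto
  moreover have "?A \<notin> depth_set m n (Suc q)"
  proof
    assume "?A \<in> depth_set m n (Suc q)"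
    then obtain F where "?A = subst_mat m n F" "fps_nth F q = 0"
      unfolding depth_set_def using assms by auto
    then have "fps_nth (1 + fps_X ^ q :: complex fps) q = 0"
      using subst_mat_row0[OF assms(2)] by metis
    then show False using assms by auto
  qed
  moreover have "depth_set m n (Suc q) \<subseteq> depth_set m n q"
    unfolding depth_set_def by auto
  ultimately show ?thesis by blast
qed

lemma depth_set_mono: "p \<le> q \<Longrightarrow> depth_set m n q \<subseteq> depth_set m n p"
  unfolding depth_set_def by (intro Collect_mono ex_mono) auto

lemma depth_set_nonempty: "depth_set m n p \<noteq> {}"
proof -
  have "subst_mat m n 1 \<in> depth_set m n p"
    unfolding depth_set_def by (intro CollectI exI[of _ 1]) auto
  then show ?thesis by blast
qed

lemma closedin_depth_set_Times:
  assumes "S \<subseteq> subst_group m n \<times> subst_group m n" "depth_set m n p \<times> depth_set m n q \<subseteq> S"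
    and "p \<le> n" "q \<le> n" "0 < n"
  shows "closedin (zariski_topology S (pair_coords n)) (depth_set m n p \<times> depth_set m n q)"
proof -
  let ?F = "(\<Union>j\<in>{0<..<p}. {\<lambda>x. fst x $$ (0, j)}) \<union> (\<Union>j\<in>{0<..<q}. {\<lambda>x. snd x $$ (0, j)})"
  have "(\<lambda>x. fst x $$ (0, j)) \<in> pair_coords n" "(\<lambda>x. snd x $$ (0, j)) \<in> pair_coords n" if "j < n" for j
    unfolding pair_coords_def using that assms(5) by blast+
  then have "?F \<subseteq> polynomial_functions (pair_coords n)"
    using assms(3,4) by (auto intro!: polynomial_functions.coord)
  moreover have "depth_set m n p \<times> depth_set m n q = zero_locus S ?F"
    using assms unfolding zero_locus_def
    by (auto simp: depth_set_eq ball_Un)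
  ultimately show ?thesis unfolding closedin_zariski_topology by blast
qed

lemma irreducible_in_depth_set_Times:
  assumes "depth_set m n p \<times> depth_set m n q \<subseteq> S"
  shows "irreducible_in (zariski_topology S (pair_coords n)) (depth_set m n p \<times> depth_set m n q)"
proof (rule irreducible_in_zariskiI[OF assms])
  show "depth_set m n p \<times> depth_set m n q \<noteq> {}" using depth_set_nonempty by blast
next
  fix x y assume xy: "x \<in> depth_set m n p \<times> depth_set m n q" "y \<in> depth_set m n p \<times> depth_set m n q"
  obtain \<gamma> where \<gamma>: "\<gamma> 0 = fst x" "\<gamma> 1 = fst y" "range \<gamma> \<subseteq> depth_set m n p"
    "\<forall>i<n. \<forall>j<n. (\<lambda>t. \<gamma> t $$ (i, j)) \<in> range poly"
    using depth_set_curve[of "fst x" m n p "fst y"] xy by auto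
  obtain \<delta> where \<delta>: "\<delta> 0 = snd x" "\<delta> 1 = snd y" "range \<delta> \<subseteq> depth_set m n q"
    "\<forall>i<n. \<forall>j<n. (\<lambda>t. \<delta> t $$ (i, j)) \<in> range poly"
    using depth_set_curve[of "snd x" m n q "snd y"] xy by auto
  show "\<exists>\<gamma>. \<gamma> 0 = x \<and> \<gamma> 1 = y \<and> range \<gamma> \<subseteq> depth_set m n p \<times> depth_set m n q \<and>
      (\<forall>f\<in>pair_coords n. (\<lambda>t. f (\<gamma> t)) \<in> range poly)"
    using \<gamma> \<delta> by (intro exI[of _ "\<lambda>t. (\<gamma> t, \<delta> t)"]) (auto simp: pair_coords_def)
qed

lemma krull_dim_ge_depth:
  assumes "S \<subseteq> subst_group m n \<times> subst_group m n" "depth_set m n p \<times> depth_set m n p \<subseteq> S"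
    and "1 \<le> p" "p \<le> n"
  shows "enat (2 * (n - p)) \<le> krull_dim (zariski_topology S (pair_coords n))"
proof -
  define K where "K = n - p"
  \<comment> \<open>The chain starts at the pair of identities; the first K steps lower the depth of
    the first factor from n to p, the next K steps that of the second. The truncated difference
    \<open>s - K\<close> keeps the second factor fixed meanwhile.\<close>
  define a where "a s = n - min s K" for s
  define b where "b s = n - (s - K)" for s
  let ?Z = "\<lambda>s. depth_set m n (a s) \<times> depth_set m n (b s)"
  have ab: "p \<le> a s" "a s \<le> n" "b s \<le> n" for s using assms by (auto simp: a_def b_def K_def)
  have bp: "p \<le> b s" if "s \<le> 2 * K" for s using assms that by (auto simp: b_def K_def)
  have sub: "?Z s \<subseteq> S" if "s \<le> 2 * K" for s
    using depth_set_mono[OF ab(1), of m n s] depth_set_mono[OF bp[OF that], of m n] assms(2) by blast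
  have "enat (2 * K) \<le> krull_dim (zariski_topology S (pair_coords n))"
  proof (rule le_krull_dim)
    fix s assume "s \<le> 2 * K"
    then show "closedin (zariski_topology S (pair_coords n)) (?Z s)"
      using assms ab sub by (intro closedin_depth_set_Times) auto
    show "irreducible_in (zariski_topology S (pair_coords n)) (?Z s)"
      using sub[OF \<open>s \<le> 2 * K\<close>] by (rule irreducible_in_depth_set_Times)
  next
    fix s assume s: "s < 2 * K"
    show "?Z s \<subset> ?Z (Suc s)"
    proof (cases "s < K")
      case True
      then have "a s = Suc (a (Suc s))" "b (Suc s) = b s" by (auto simp: a_def b_def K_def)
      then have "depth_set m n (a s) \<subset> depth_set m n (a (Suc s))" "b (Suc s) = b s"
        using depth_set_strict[of "a (Suc s)" n m] assms(3) ab[of s] ab[of "Suc s"] by auto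
      then show ?thesis using depth_set_nonempty[of m n "b s"] by auto
    next
      case False
      then have "b s = Suc (b (Suc s))" "a (Suc s) = a s" using s by (auto simp: a_def b_def K_def)
      then have "depth_set m n (b s) \<subset> depth_set m n (b (Suc s))" "a (Suc s) = a s"
        using depth_set_strict[of "b (Suc s)" n m] assms(3) ab[of s] bp[of "Suc s"] s by auto
      then show ?thesis using depth_set_nonempty[of m n "a s"] by auto
    qed
  qed
  then show ?thesis by (simp add: K_def)
qed

lemma fps_power_nth_low:
  fixes F :: "complex fps"
  assumes "fps_nth F 0 = 1" "\<And>l. 0 < l \<Longrightarrow> l < p \<Longrightarrow> fps_nth F l = 0" "0 < s" "s \<le> p"
  shows "fps_nth (F ^ k) s = of_nat k * fps_nth F s"
  using assms(3,4)
proof (induction k arbitrary: s)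
  case (Suc k)
  have "fps_nth (F ^ Suc k) s = (\<Sum>l\<in>{0..s}. fps_nth F l * fps_nth (F ^ k) (s - l))"
    by (simp add: fps_mult_nth)
  also have "\<dots> = (\<Sum>l\<in>{0, s}. fps_nth F l * fps_nth (F ^ k) (s - l))"
    using Suc.prems assms(2) by (intro sum.mono_neutral_right) auto
  also have "\<dots> = of_nat (Suc k) * fps_nth F s"
    using Suc assms(1) fps_power_nth_0_eq_1[OF assms(1)] by (simp add: algebra_simps)
  finally show ?case .
qed auto

text \<open>Up to index m, hence at most 2p, composition adds the coefficients of positive index,
  except for one extra term (p + 1) U_p V_p at index 2p, which is symmetric in both factors.\<close>

lemma depth_set_commute:
  assumes "m < n" "0 < p" "m \<le> 2 * p" "A \<in> depth_set m n p" "B \<in> depth_set m n p"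
  shows "A * B = B * A"
proof -
  obtain F H where F: "A = subst_mat m n F" "fps_nth F 0 = 1" "\<And>j. 0 < j \<Longrightarrow> j < p \<Longrightarrow> fps_nth F j = 0"
    and H: "B = subst_mat m n H" "fps_nth H 0 = 1" "\<And>j. 0 < j \<Longrightarrow> j < p \<Longrightarrow> fps_nth H j = 0"
    using assms(4,5) unfolding depth_set_def by blast
  have eval: "(\<Sum>k\<le>j. fps_nth U k * fps_nth (V ^ Suc k) (j - k)) =
      (if j = 0 then 1 else fps_nth U j + fps_nth V j +
        (if j = 2 * p then of_nat (Suc p) * fps_nth U p * fps_nth V p else 0))"
    if U: "fps_nth U 0 = 1" "\<And>j. 0 < j \<Longrightarrow> j < p \<Longrightarrow> fps_nth U j = 0"
      and V: "fps_nth V 0 = 1" "\<And>j. 0 < j \<Longrightarrow> j < p \<Longrightarrow> fps_nth V j = 0" and j: "j \<le> 2 * p"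
    for U V :: "complex fps" and j
  proof (cases "j = 0")
    case False
    have low: "fps_nth (V ^ Suc k) (j - k) = 0" if "p \<le> k" "k < j" "k \<noteq> p \<or> j \<noteq> 2 * p" for k
    proof -
      have "0 < j - k" "j - k < p" using that j by auto
      then show ?thesis using fps_power_nth_low[OF V] V(2) by (simp del: power_Suc)
    qed
    have "(\<Sum>k\<le>j. fps_nth U k * fps_nth (V ^ Suc k) (j - k)) =
        (\<Sum>k\<in>{0, j} \<union> (if j = 2 * p then {p} else {}). fps_nth U k * fps_nth (V ^ Suc k) (j - k))"
    proof (rule sum.mono_neutral_right)
      show "\<forall>k\<in>{..j} - ({0, j} \<union> (if j = 2 * p then {p} else {})). fps_nth U k * fps_nth (V ^ Suc k) (j - k) = 0"
      proof
        fix k assume k: "k \<in> {..j} - ({0, j} \<union> (if j = 2 * p then {p} else {}))"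
        then show "fps_nth U k * fps_nth (V ^ Suc k) (j - k) = 0"
          using U(2)[of k] low[of k] by (cases "k < p") (auto split: if_splits)
      qed
    qed (use j in auto)
    also have "\<dots> = fps_nth V j + fps_nth U j +
        (if j = 2 * p then of_nat (Suc p) * fps_nth U p * fps_nth V p else 0)"
      using False assms(2) U(1) V(1) fps_power_nth_0_eq_1[OF V(1), of "Suc j"]
        fps_power_nth_low[OF V, where s = p and k = "Suc p"]
      by (auto simp del: power_Suc)
    finally show ?thesis using False by simp
  qed (use U V in simp)
  show ?thesis
    unfolding F(1) H(1) subst_mat_commute_iff[OF assms(1) F(2) H(2)]
    using eval[OF F(2,3) H(2,3)] eval[OF H(2,3) F(2,3)] assms(3) by (auto simp: algebra_simps)
qed

section \<open>Upper bounds: free coordinates on the pieces\<close>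

text \<open>On the group every entry is a polynomial in the entries of row 0, so tameness has to be
  checked for row 0 only.\<close>

lemma pair_coords_tame:
  assumes "0 < n" "P \<subseteq> subst_group m n \<times> subst_group m n" "h \<in> deg_le Y 1"
    and "\<And>s. 0 < s \<Longrightarrow> s < n \<Longrightarrow> (\<lambda>x. fst x $$ (0, s)) \<in> (\<Union>D. tame h Y P D)"
    and "\<And>s. 0 < s \<Longrightarrow> s < n \<Longrightarrow> (\<lambda>x. snd x $$ (0, s)) \<in> (\<Union>D. tame h Y P D)"
  shows "pair_coords n \<subseteq> (\<Union>D. tame h Y P D)"
proof -
  interpret function_ring "\<Union>D. tame h Y P D" by (rule function_ring_tame[OF assms(3)])
  have eq: "subst_mat m n (row_fps n (fst x)) = fst x" "subst_mat m n (row_fps n (snd x)) = snd x"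
    if "x \<in> P" for x
    using that assms(2) subst_group_iff[OF assms(1)] by auto
  have "(\<lambda>x. fst x $$ (i, j)) \<in> (\<Union>D. tame h Y P D)" if "i < n" "j < n" for i j
  proof -
    have "(\<lambda>x. subst_mat m n (row_fps n (fst x)) $$ (i, j)) \<in> (\<Union>D. tame h Y P D)"
      using that by (intro subst_mat_entry row_fps_nth_in assms(4))
    then show ?thesis by (rule tame_cong) (simp add: eq(1))
  qed
  moreover have "(\<lambda>x. snd x $$ (i, j)) \<in> (\<Union>D. tame h Y P D)" if "i < n" "j < n" for i j
  proof -
    have "(\<lambda>x. subst_mat m n (row_fps n (snd x)) $$ (i, j)) \<in> (\<Union>D. tame h Y P D)"
      using that by (intro subst_mat_entry row_fps_nth_in assms(5))
    then show ?thesis by (rule tame_cong) (simp add: eq(2))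
  qed
  ultimately show ?thesis unfolding pair_coords_def by blast
qed

lemma krull_dim_subst_group_Times_le:
  assumes "m < n"
  shows "krull_dim (zariski_topology (subst_group m n \<times> subst_group m n) (pair_coords n)) \<le> enat (2 * (n - 1))"
proof -
  let ?P = "subst_group m n \<times> subst_group m n"
  define Y :: "(complex mat \<times> complex mat \<Rightarrow> complex) set"
    where "Y = (\<lambda>s x. fst x $$ (0, s)) ` {1..<n} \<union> (\<lambda>s x. snd x $$ (0, s)) ` {1..<n}"
  have fin: "finite Y" by (simp add: Y_def)
  have "card Y \<le> card {1..<n} + card {1..<n}"
    unfolding Y_def by (intro order.trans[OF card_Un_le] add_mono card_image_le) auto
  then have card: "card Y \<le> 2 * (n - 1)" by simp
  have h: "(\<lambda>_. 1) \<in> deg_le Y 1" by (rule deg_le_const)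
  have coord: "y \<in> (\<Union>D. tame (\<lambda>_. 1) Y ?P D)" if "y \<in> Y" for y
    using tame_coord[OF fin that h] by blast
  have "pair_coords n \<subseteq> (\<Union>D. tame (\<lambda>_. 1) Y ?P D)"
  proof (rule pair_coords_tame[OF _ order.refl h])
    fix s assume "0 < s" "s < n"
    then show "(\<lambda>x. fst x $$ (0, s)) \<in> (\<Union>D. tame (\<lambda>_. 1) Y ?P D)"
      "(\<lambda>x. snd x $$ (0, s)) \<in> (\<Union>D. tame (\<lambda>_. 1) Y ?P D)"
      by (intro coord; simp add: Y_def)+
  qed (use assms in simp)
  then show ?thesis
    using fin card h
    by (intro krull_dim_le[where I = "{()}" and P = "\<lambda>_. ?P" and Y = "\<lambda>_. Y" and h = "\<lambda>_ _. 1"]) auto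
qed

text \<open>
  If \<open>F\<close> has its first nonzero coefficient at \<open>i\<close>, comparing the coefficients of
  \<open>t ^ (i + s + 1)\<close> in both compositions determines \<open>(i - s) * F\<^sub>i * H\<^sub>s\<close> by \<open>F\<close> and the
  coefficients of \<open>H\<close> with index less than \<open>s\<close>.
\<close>

lemma commuting_coefficient:
  fixes F H :: "complex fps"
  assumes F0: "fps_nth F 0 = 1" and H0: "fps_nth H 0 = 1" and "0 < i" "0 < s"
    and F: "\<And>l. 0 < l \<Longrightarrow> l < i \<Longrightarrow> fps_nth F l = 0"
    and comm: "(\<Sum>k\<le>i+s. fps_nth F k * fps_nth (H ^ Suc k) (i + s - k)) =
      (\<Sum>k\<le>i+s. fps_nth H k * fps_nth (F ^ Suc k) (i + s - k))"
  shows "(of_nat i - of_nat s) * fps_nth F i * fps_nth H s =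
    (\<Sum>k<s. fps_nth H k * fps_nth (F ^ Suc k) (i + s - k))
    - (\<Sum>k\<in>{i<..i+s}. fps_nth F k * fps_nth (H ^ Suc k) (i + s - k))
    - fps_nth F i * (fps_nth (H ^ Suc i) s - of_nat (Suc i) * fps_nth H s)"
proof -
  let ?f = "\<lambda>k. fps_nth F k * fps_nth (H ^ Suc k) (i + s - k)"
  let ?g = "\<lambda>k. fps_nth H k * fps_nth (F ^ Suc k) (i + s - k)"
  have low: "fps_nth (F ^ k) l = of_nat k * fps_nth F l" if "0 < l" "l \<le> i" for k l
    using F0 F that by (intro fps_power_nth_low) auto
  have "(\<Sum>k\<le>i+s. ?f k) = (\<Sum>k\<in>insert 0 (insert i {i<..i+s}). ?f k)"
    using F by (intro sum.mono_neutral_right) auto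
  also have "\<dots> = ?f 0 + (?f i + (\<Sum>k\<in>{i<..i+s}. ?f k))"
    using assms(3) by simp
  finally have L: "(\<Sum>k\<le>i+s. ?f k) = ?f 0 + (?f i + (\<Sum>k\<in>{i<..i+s}. ?f k))" .
  have "(\<Sum>k\<le>i+s. ?g k) = (\<Sum>k\<in>insert (i+s) (insert s {..<s}). ?g k)"
  proof (rule sum.mono_neutral_right)
    show "\<forall>k\<in>{..i+s} - insert (i+s) (insert s {..<s}). ?g k = 0"
    proof
      fix k assume "k \<in> {..i+s} - insert (i+s) (insert s {..<s})"
      then have "0 < i + s - k" "i + s - k < i" by auto
      then show "?g k = 0" using low[of "i + s - k" "Suc k"] F[of "i + s - k"] by simp
    qed
  qed auto
  also have "\<dots> = ?g (i + s) + (?g s + (\<Sum>k<s. ?g k))"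
    using assms(3) by simp
  finally have R: "(\<Sum>k\<le>i+s. ?g k) = ?g (i + s) + (?g s + (\<Sum>k<s. ?g k))" .
  \<comment> \<open>The coefficient of H at index i + s occurs once on each side and cancels; no
    coefficient of H beyond s remains.\<close>
  have "?f 0 = fps_nth H (i + s)" "?g (i + s) = fps_nth H (i + s)"
    using F0 fps_power_nth_0_eq_1[OF F0, of "Suc (i + s)"] by (simp_all del: power_Suc add: power_one_right)
  moreover have "?g s = fps_nth H s * (of_nat (Suc s) * fps_nth F i)"
    using low[of i "Suc s"] assms(3) by (simp del: power_Suc)
  moreover have "?f i = fps_nth F i * fps_nth (H ^ Suc i) s" by simp
  ultimately show ?thesis using comm L R F0 fps_power_nth_0_eq_1[OF F0, of "Suc (i + s)"]
    by (simp add: algebra_simps del: power_Suc)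
qed

text \<open>The coefficients \<open>b s\<close> are obtained by recursion on s from the commutation
  equation at index i + s, with \<open>a i\<close> as the only denominator. For s = i the factor i -
  s vanishes, and for s > m - i there is no equation; these \<open>b s\<close> stay free.\<close>

lemma commuting_piece_tame:
  fixes m n i :: nat
  defines "a \<equiv> \<lambda>s x. fst x $$ (0, s)" and "b \<equiv> \<lambda>s x. snd x $$ (0, s)"
  assumes "m < n" "0 < i" "i \<le> m"
    and P: "P \<subseteq> commuting_variety (subst_group m n)"
      "\<And>x l. x \<in> P \<Longrightarrow> 0 < l \<Longrightarrow> l < i \<Longrightarrow> a l x = 0" "\<And>x. x \<in> P \<Longrightarrow> a i x \<noteq> 0"
    and Y: "finite Y" "\<And>s. i \<le> s \<Longrightarrow> s < n \<Longrightarrow> a s \<in> Y" "b i \<in> Y"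
      "\<And>s. m - i < s \<Longrightarrow> s < n \<Longrightarrow> b s \<in> Y"
  shows "pair_coords n \<subseteq> (\<Union>D. tame (a i) Y P D)"
proof -
  have h: "a i \<in> deg_le Y 1" using assms by (intro deg_le_coord) auto
  let ?R = "\<Union>D. tame (a i) Y P D"
  interpret function_ring ?R by (rule function_ring_tame[OF h])
  have coord: "y \<in> ?R" if "y \<in> Y" for y
    using tame_coord[OF Y(1) that h] by blast
  define F where "F x = row_fps n (fst x)" for x :: "complex mat \<times> complex mat"
  define H where "H x = row_fps n (snd x)" for x :: "complex mat \<times> complex mat"
  have nth: "fps_nth (F x) s = (if s = 0 then 1 else a s x)"
    "fps_nth (H x) s = (if s = 0 then 1 else b s x)" if "s < n" for x s
    using that by (auto simp: F_def H_def row_fps_nth a_def b_def)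
  have aR: "a s \<in> ?R" if "0 < s" "s < n" for s
  proof (cases "s < i")
    case True
    then show ?thesis using P(2) that by (intro tame_cong[OF const[of 0]]) auto
  qed (use that Y(2) coord in auto)
  have FR: "(\<lambda>x. fps_nth (F x) s) \<in> ?R" for s
    unfolding F_def by (rule row_fps_nth_in) (use aR in \<open>simp add: a_def\<close>)
  have bR: "b s \<in> ?R" if "0 < s" "s < n" for s
    using that
  proof (induction s rule: less_induct)
    case (less s)
    show ?case
    proof (cases "s = i \<or> m - i < s")
      case True
      then show ?thesis using Y less.prems coord by auto
    next
      case False
      then have s: "s \<noteq> i" "i + s \<le> m" using assms by auto
      have HR: "(\<lambda>x. fps_nth (H x) l) \<in> ?R" if "l < s" for l
        using less.IH[of l] that less.prems const[of 1] by (cases "l = 0") (simp_all add: nth)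
      \<comment> \<open>The right-hand side of \<open>commuting_coefficient\<close>. By
        \<open>fps_power_nth_linear\<close> the last bracket, too, involves only coefficients of H
        below s.\<close>
      define T where "T x = (\<Sum>k<s. fps_nth (H x) k * fps_nth (F x ^ Suc k) (i + s - k))
        - (\<Sum>k\<in>{i<..i+s}. fps_nth (F x) k * fps_nth (H x ^ Suc k) (i + s - k))
        - fps_nth (F x) i * (fps_nth (H x ^ Suc i) s - of_nat (Suc i) * fps_nth (H x) s)" for x
      have "T \<in> ?R"
        unfolding T_def[abs_def] using less.prems
        by (intro diff sum mult FR HR fps_power_nth fps_power_nth_linear)
          (auto simp: H_def row_fps_nth)
      moreover have inv: "(\<lambda>x. 1 / a i x) \<in> ?R" using tame_inverse[of P "a i" Y] P(3) by blast
      ultimately have "(\<lambda>x. 1 / (of_nat i - of_nat s) * ((1 / a i x) * T x)) \<in> ?R"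
        by (intro mult const)
      then show ?thesis
      proof (rule tame_cong)
        fix x assume x: "x \<in> P"
        have G: "fst x \<in> subst_group m n" "snd x \<in> subst_group m n" "fst x * snd x = snd x * fst x"
          using P(1) x unfolding commuting_variety_def by auto
        then have "fst x = subst_mat m n (F x)" "snd x = subst_mat m n (H x)"
          unfolding F_def H_def using subst_group_iff[of n] assms(3) by auto
        then have comm: "subst_mat m n (F x) * subst_mat m n (H x) = subst_mat m n (H x) * subst_mat m n (F x)"
          using G(3) by simp
        have 0: "fps_nth (F x) 0 = 1" "fps_nth (H x) 0 = 1" by (auto simp: F_def H_def row_fps_nth)
        have "(of_nat i - of_nat s) * fps_nth (F x) i * fps_nth (H x) s = T x"
          unfolding T_def
        proof (rule commuting_coefficient[OF 0 assms(4)])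
          show "fps_nth (F x) l = 0" if "0 < l" "l < i" for l
            using P(2)[OF x] that assms nth(1) by auto
        qed (use comm s less.prems in \<open>auto simp: subst_mat_commute_iff[OF assms(3) 0]\<close>)
        moreover have "fps_nth (F x) i = a i x" "fps_nth (H x) s = b s x"
          using nth assms less.prems by auto
        moreover have "(of_nat i - of_nat s :: complex) \<noteq> 0" using s by simp
        ultimately show "1 / (of_nat i - of_nat s) * ((1 / a i x) * T x) = b s x"
          using P(3)[OF x] by (simp add: field_simps)
      qed
    qed
  qed
  show ?thesis
  proof (rule pair_coords_tame[OF _ _ h])
    show "P \<subseteq> subst_group m n \<times> subst_group m n"
      using P(1) unfolding commuting_variety_def by auto
  qed (use assms(3) aR bR in \<open>auto simp: a_def b_def\<close>)
qed

text \<open>For i > 0 the piece \<open>P i\<close> has n - i free coordinates in the first entry and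
  at most n - m + i in the second, so the bound 2n - m is the same for all i; the central piece
  needs only 2n - m - 2.\<close>

lemma krull_dim_commuting_variety_le:
  assumes "m < n"
  shows "krull_dim (zariski_topology (commuting_variety (subst_group m n)) (pair_coords n))
    \<le> enat (2 * n - m)"
proof -
  let ?S = "commuting_variety (subst_group m n)"
  define a :: "nat \<Rightarrow> complex mat \<times> complex mat \<Rightarrow> complex" where "a s x = fst x $$ (0, s)" for s x
  define b :: "nat \<Rightarrow> complex mat \<times> complex mat \<Rightarrow> complex" where "b s x = snd x $$ (0, s)" for s x
  \<comment> \<open>\<open>P i\<close> collects the pairs whose first entry has its first nonzero coefficient at \<open>i\<close>;
    \<open>P 0\<close> collects those whose first entry is central.\<close>
  define P where "P i = (if i = 0 then {x \<in> ?S. \<forall>l. 0 < l \<and> l \<le> m \<longrightarrow> a l x = 0}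
    else {x \<in> ?S. (\<forall>l. 0 < l \<and> l < i \<longrightarrow> a l x = 0) \<and> a i x \<noteq> 0})" for i
  define Y where "Y i = (if i = 0 then a ` {m<..<n} \<union> b ` {0<..<n}
    else a ` {i..<n} \<union> b ` insert i {m - i<..<n})" for i
  define h where "h i = (if i = 0 then (\<lambda>_. 1) else a i)" for i
  show ?thesis
  proof (rule krull_dim_le[where I = "{..m}" and P = P and Y = Y and h = h])
    show "?S = (\<Union>i\<in>{..m}. P i)"
    proof
      show "?S \<subseteq> (\<Union>i\<in>{..m}. P i)"
      proof
        fix x assume x: "x \<in> ?S"
        show "x \<in> (\<Union>i\<in>{..m}. P i)"
        proof (cases "\<exists>l. 0 < l \<and> l \<le> m \<and> a l x \<noteq> 0")
          case True
          define i where "i = (LEAST l. 0 < l \<and> l \<le> m \<and> a l x \<noteq> 0)"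
          have i: "0 < i \<and> i \<le> m \<and> a i x \<noteq> 0"
            unfolding i_def using True by (rule LeastI_ex)
          moreover have "a l x = 0" if "0 < l" "l < i" for l
            using not_less_Least[of l "\<lambda>l. 0 < l \<and> l \<le> m \<and> a l x \<noteq> 0"] that i unfolding i_def by auto
          ultimately have "x \<in> P i" using x by (auto simp: P_def)
          then show ?thesis using i by auto
        next
          case False
          then have "x \<in> P 0" using x by (auto simp: P_def)
          then show ?thesis by auto
        qed
      qed
    qed (auto simp: P_def split: if_splits)
  next
    fix i assume i: "i \<in> {..m}"
    show fin: "finite (Y i)" by (simp add: Y_def)
    show "card (Y i) \<le> 2 * n - m"
    proof (cases "i = 0")
      case True
      have "card (Y i) \<le> card {m<..<n} + card {0<..<n}"
        unfolding Y_def using True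
        by (simp del: card_greaterThanLessThan)
          (intro order.trans[OF card_Un_le] add_mono card_image_le finite_greaterThanLessThan)
      then show ?thesis using assms by simp
    next
      case False
      have "card (Y i) \<le> card {i..<n} + card (insert i {m - i<..<n})"
        unfolding Y_def using False
        by (simp del: image_insert card_greaterThanLessThan card_atLeastLessThan)
          (intro order.trans[OF card_Un_le] add_mono card_image_le; simp)
      also have "card (insert i {m - i<..<n}) \<le> Suc (card {m - i<..<n})"
        by (rule card_insert_le_m1) auto
      finally show ?thesis using i assms by simp
    qed
    show h: "h i \<in> deg_le (Y i) 1"
      using fin i assms by (auto simp: h_def Y_def intro!: deg_le_const deg_le_coord)
    show "h i x \<noteq> 0" if "x \<in> P i" for x
      using that by (auto simp: h_def P_def split: if_splits)
    show "pair_coords n \<subseteq> (\<Union>D. tame (h i) (Y i) (P i) D)"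
    proof (cases "i = 0")
      case True
      interpret function_ring "\<Union>D. tame (h i) (Y i) (P i) D" by (rule function_ring_tame[OF h])
      have coord: "y \<in> (\<Union>D. tame (h i) (Y i) (P i) D)" if "y \<in> Y i" for y
        using tame_coord[OF fin that h] by blast
      show ?thesis
      proof (rule pair_coords_tame[OF _ _ h])
        show "P i \<subseteq> subst_group m n \<times> subst_group m n"
          by (auto simp: P_def commuting_variety_def split: if_splits)
        fix s assume s: "0 < s" "s < n"
        show "(\<lambda>x. snd x $$ (0, s)) \<in> (\<Union>D. tame (h i) (Y i) (P i) D)"
          using s True by (intro coord) (auto simp: Y_def b_def[abs_def])
        show "(\<lambda>x. fst x $$ (0, s)) \<in> (\<Union>D. tame (h i) (Y i) (P i) D)"
        proof (cases "s \<le> m")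
          case s': True
          show ?thesis
            by (rule tame_cong[OF const[of 0]]) (use s s' True in \<open>auto simp: P_def a_def\<close>)
        next
          case False
          then show ?thesis using s True by (intro coord) (auto simp: Y_def a_def[abs_def])
        qed
      qed (use assms in auto)
    next
      case False
      then have "pair_coords n \<subseteq> (\<Union>D. tame (\<lambda>x. fst x $$ (0, i)) (Y i) (P i) D)"
        using i assms fin
        by (intro commuting_piece_tame[of m n i])
          (auto simp: P_def Y_def a_def[abs_def] b_def[abs_def])
      then show ?thesis using False by (simp add: h_def a_def[abs_def])
    qed
  qed auto
qed

section \<open>The commuting probability of the substitution group\<close>

lemma infinite_subst_group:
  assumes "1 < n"
  shows "infinite (subst_group m n)"
proof
  let ?f = "\<lambda>c. subst_mat m n (1 + fps_const c * fps_X)"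
  assume fin: "finite (subst_group m n)"
  have "range ?f \<subseteq> subst_group m n"
    unfolding subst_group_def by fastforce
  moreover have "inj ?f"
  proof
    fix c d assume "?f c = ?f d"
    then have "?f c $$ (0, 1) = ?f d $$ (0, 1)" by simp
    then show "c = d" using subst_mat_row0[OF assms, of m] by simp
  qed
  ultimately have "finite (UNIV :: complex set)" using fin finite_subset finite_imageD by blast
  then show False by (simp add: infinite_UNIV_char_0)
qed

theorem commuting_probability_subst_group:
  assumes "m < n" "even m" "0 < m"
  shows "commuting_probability n (subst_group m n) = real (2 * n - m) / real (2 * (n - 1))"
proof -
  let ?G = "subst_group m n"
  have sub: "?G \<times> ?G \<subseteq> carrier_mat n n \<times> carrier_mat n n" by (auto simp: subst_group_def)
  have subC: "commuting_variety ?G \<subseteq> ?G \<times> ?G" by (auto simp: commuting_variety_def)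
  have "enat (2 * (n - 1)) \<le> krull_dim (zariski_topology (?G \<times> ?G) (pair_coords n))"
    using assms by (intro krull_dim_ge_depth[where m = m]) (auto simp: depth_set_1[simplified])
  then have dimG: "variety_pair_dim n (?G \<times> ?G) = enat (2 * (n - 1))"
    using krull_dim_subst_group_Times_le[OF assms(1)] variety_pair_dim_eq[OF sub] by simp
  \<comment> \<open>Evenness of m lets the chain in the square of the abelian subgroup of depth m /
    2 reach the upper bound 2n - m exactly.\<close>
  obtain p where p: "m = 2 * p" using assms(2) by blast
  have "depth_set m n p \<subseteq> ?G" unfolding depth_set_def subst_group_def by auto
  then have "depth_set m n p \<times> depth_set m n p \<subseteq> commuting_variety ?G"
    using depth_set_commute[OF assms(1), of p] p assms(3) unfolding commuting_variety_def by auto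
  then have "enat (2 * (n - p)) \<le> krull_dim (zariski_topology (commuting_variety ?G) (pair_coords n))"
    using assms p by (intro krull_dim_ge_depth[OF subC]) auto
  moreover have "2 * (n - p) = 2 * n - m" using p by simp
  ultimately have dimC: "variety_pair_dim n (commuting_variety ?G) = enat (2 * n - m)"
    using krull_dim_commuting_variety_le[OF assms(1)]
      variety_pair_dim_eq[OF order.trans[OF subC sub]] by (metis antisym)
  show ?thesis
    unfolding commuting_probability_def dimG dimC using infinite_subst_group[of n m] assms by simp
qed

theorem proposition5p3:
  fixes \<alpha> :: real
  assumes "\<alpha> \<in> \<rat>" and "1 / 2 < \<alpha>" and "\<alpha> \<le> 1"
  shows "\<exists>n G. linear_algebraic_group n G \<and> zariski_connected n G \<and>
           nilpotent_group ((GL n)\<lparr>carrier := G\<rparr>) \<and> commuting_probability n G = \<alpha>"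
proof -
  have "1 - \<alpha> \<in> \<rat>" using assms(1) by simp
  then obtain r s where "s \<noteq> 0" and rs: "\<bar>1 - \<alpha>\<bar> = real r / real s"
    by (rule Rats_abs_nat_div_natE)
  then have rs: "\<alpha> = 1 - real r / real s" using assms(3) by simp
  have "real r / real s < 1 / 2" using assms(2) rs by simp
  \<comment> \<open>For integers, 2r < s is equivalent to 4r + 2 < 2s + 1, which is the condition m
    < n for the parameters chosen next.\<close>
  then have less: "2 * r < s" using \<open>s \<noteq> 0\<close> by (simp add: field_simps)
  \<comment> \<open>The commuting probability of \<open>subst_group m n\<close> is \<open>1 - (m - 2) / (2 * (n - 1))\<close>.\<close>
  define m where "m = 4 * r + 2"
  define n where "n = 2 * s + 1"
  have mn: "m < n" using less by (simp add: m_def n_def)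
  have "commuting_probability n (subst_group m n) = real (2 * n - m) / real (2 * (n - 1))"
    using mn by (intro commuting_probability_subst_group) (auto simp: m_def)
  also have "\<dots> = \<alpha>"
    using \<open>s \<noteq> 0\<close> less unfolding rs by (simp add: m_def n_def of_nat_diff field_simps)
  finally show ?thesis
    using linear_algebraic_group_subst_group[OF mn] zariski_connected_subst_group
      nilpotent_group_unipotent[OF subgroup_subst_group[OF mn] subst_group_unipotent]
    by blast
qed

end
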